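(* Let $V$ be a real vector space of dimension $n$, $M\subset V$ a lattice, and $P\subset V$ an $n$-dimensional lattice polytope (not necessarily simple). Let $\varphi\colon V\to\mathbb{C}$ be a nonzero homogeneous polynomial function of degree $\deg\varphi$. For each nonempty face $F$ of $P$ let $D_{\varphi,F}(q)$ be the polynomial in $q$ equal to $\sum_{m\in M\cap qF}\varphi(m)$ for all positive integers $q$, and define \[ G_\varphi(q,y):=(y+1)^{\deg\varphi}\sum_{F}(y+1)^{\dim F}(-y)^{n-\dim F}\,D_{\varphi,F}(q)\,\tilde g_F\!\left(-\tfrac1y\right), \] the sum over all nonempty faces $F$ of $P$. Then, as rational functions of $q,y$, \[ G_\varphi(q,y)=(-y)^{n+\deg\varphi}\,G_\varphi\!\left(-q,\tfrac1y\right). \]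
   Context: Lattice polytope: vertices in $M$. For a face $F$ of $P$, $\tilde g_F(x):=g_{P^\diamond(F)}(x)$, where $P^\diamond(F)$ is the face of the polar polytope of $P$ dual to $F$ (its face poset is the interval $[F,P]$ of the face poset of $P$ with order reversed; $P^\diamond(P)$ is the empty face). The $g$-polynomial is defined recursively: for the empty face, $f=g=1$; if $\dim Q=k\ge 0$ then $f_Q(x)=\sum_{F}g_F(x)(x-1)^{k-1-\dim F}$, summed over all proper faces $F$ of $Q$ including the empty face (of dimension $-1$), and writing $f_Q=\sum_{l=0}^k f_lx^l$, $m=\lfloor k/2\rfloor$, one sets $g_Q(x)=f_0+(f_1-f_0)x+\dots+(f_m-f_{m-1})x^m$. (If $P$ is simple, all $\tilde g_F=1$.) *)

theory Defs
  imports "HOL-Analysis.Analysis" "HOL-Computational_Algebra.Polynomial"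
begin

definition lattice_of :: "real^'n^'n \<Rightarrow> (real^'n) set" where
  "lattice_of A = (\<lambda>z. A *v z) ` {z. \<forall>i. z$i \<in> \<int>}"

definition is_lattice :: "(real^'n) set \<Rightarrow> bool" where
  "is_lattice M \<longleftrightarrow> (\<exists>A. invertible A \<and> M = lattice_of A)"

definition lattice_polytope :: "(real^'n) set \<Rightarrow> (real^'n) set \<Rightarrow> bool" where
  "lattice_polytope M P \<longleftrightarrow> (\<exists>S. finite S \<and> S \<subseteq> M \<and> P = convex hull S)"

definition homog_poly_fun :: "nat \<Rightarrow> (real^'n \<Rightarrow> complex) \<Rightarrow> bool" where
  "homog_poly_fun d \<phi> \<longleftrightarrow> (\<exists>c :: ('n \<Rightarrow> nat) \<Rightarrow> complex. \<forall>x.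
     \<phi> x = (\<Sum>\<alpha>\<in>{\<alpha>. sum \<alpha> UNIV = d}. c \<alpha> * (\<Prod>i\<in>UNIV. complex_of_real (x$i) ^ \<alpha> i)))"

text \<open>Truncation step of the g-polynomial: from f_Q (dim Q = k) to g_Q.\<close>
definition g_trunc :: "nat \<Rightarrow> complex poly \<Rightarrow> complex poly" where
  "g_trunc k f = (\<Sum>l\<in>{0..k div 2}.
      monom (coeff f l - (if l = 0 then 0 else coeff f (l - 1))) l)"

text \<open>g-polynomial of the dual face P^dual(F), computed from the interval [F,P] of the face
  poset of P: the proper faces of P^dual(F) are the P^dual(G) for faces G of P with F strictly
  contained in G (G = P giving the empty face); dim P^dual(G) = dim P - 1 - dim G.
  The recursion is run with a fuel parameter (sufficient fuel is supplied in gtilde).\<close>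
fun gdual_fuel :: "nat \<Rightarrow> (real^'n) set \<Rightarrow> (real^'n) set \<Rightarrow> complex poly" where
  "gdual_fuel 0 P F = 1"
| "gdual_fuel (Suc r) P F = (if F = P then 1 else
     g_trunc (nat (aff_dim P - aff_dim F - 1))
       (\<Sum>G\<in>{G. G face_of P \<and> F \<subset> G}.
          gdual_fuel r P G * [:-1, 1:] ^ nat (aff_dim G - aff_dim F - 1)))"

definition gtilde :: "(real^'n) set \<Rightarrow> (real^'n) set \<Rightarrow> complex poly" where
  "gtilde P F = gdual_fuel (Suc (nat (aff_dim P))) P F"

definition weighted_ehrhart :: "(real^'n \<Rightarrow> complex) \<Rightarrow> (real^'n) set \<Rightarrow> (real^'n) set \<Rightarrow> complex poly" where
  "weighted_ehrhart \<phi> M F = (THE p. \<forall>q::nat. q > 0 \<longrightarrow>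
      poly p (of_nat q) = (\<Sum>m\<in>M \<inter> ((\<lambda>x. real q *\<^sub>R x) ` F). \<phi> m))"

definition Gphi :: "nat \<Rightarrow> (real^'n \<Rightarrow> complex) \<Rightarrow> (real^'n) set \<Rightarrow> (real^'n) set
                     \<Rightarrow> complex \<Rightarrow> complex \<Rightarrow> complex" where
  "Gphi d \<phi> M P q y = (y + 1) ^ d *
     (\<Sum>F\<in>{F. F face_of P \<and> F \<noteq> {}}.
        (y + 1) ^ nat (aff_dim F) * (- y) ^ (CARD('n) - nat (aff_dim F)) *
        poly (weighted_ehrhart \<phi> M F) q * poly (gtilde P F) (- 1 / y))"

end

(*
  Reciprocity for lattice polytopes with polynomial weights is proved from a decomposition into
  half-open simplices: a generic interior point w tells which facets of each simplex of a
  pulling triangulation to keep. Moving away from w instead of towards it exchanges the closed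
  polytope with its relative interior, and the kept facets with the removed ones.

  Comparing the counting polynomial of P at -q with those of its faces gives an Euler relation
  weighted by an arbitrary polynomial. As polynomials separate lattice points, the weights can be
  removed, which shows that all intervals [F,H] of nonempty faces are Eulerian. Stanley's duality
  for g-polynomials follows, and this is exactly what remains of the functional equation after
  D_F(q) has been expanded over the relative interiors of the faces of F and D_F(-q) has been
  replaced by the sum over the relative interior of F.
*)

theory Submission
  imports Defs
begin

section \<open>Sums of polynomials over compositions\<close>

text \<open>The sign in reciprocity comes from summation alone. In coordinates on the vertices of a
  simplex, lattice points of its q-fold dilate are coefficient families with sum q, and splitting
  off integer parts turns the count into a sum over compositions. A sum from 0 to N continues to
  negative N as minus the sum from N+1 to -1. Hence nonnegative parts continue to negative parts,
  with one sign for every part after the first, which gives (-1)^dim.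

  Half-open pieces are used because closed simplices overlap: inclusion-exclusion over their common
  faces would call for Euler relations, which are themselves to be deduced from reciprocity.

  The weight \<phi> therefore has two roles. It is part of the statement, and it is also a test
  function: a constant weight gives a single relation for all of P, while varying \<phi> isolates
  the faces through one chosen rational point. The faces F in the sum are nonempty, so only
  intervals with nonempty lower end matter and the empty face never enters.\<close>

lemma antidifference_monomial:
  "\<exists>F :: complex poly. \<forall>x. poly F x - poly F (x - 1) = x ^ e"
proof (induction e rule: less_induct)
  case (less e)
  then obtain G :: "nat \<Rightarrow> complex poly"
    where G: "\<And>i x. i < e \<Longrightarrow> poly (G i) x - poly (G i) (x - 1) = x ^ i"
    by metis
  \<comment> \<open>The \<open>c i\<close> are the coefficients of (x - 1)^(e+1). Its two leading
    terms leave (e+1) x^e in x^(e+1) - (x - 1)^(e+1); the lower powers are cancelled by the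
    antidifferences \<open>G i\<close>.\<close>
  define c where "c i = (of_nat (Suc e choose i) * (-1) ^ (Suc e - i) :: complex)" for i
  define F where "F = smult (1 / of_nat (Suc e))
    (monom 1 (Suc e) + (\<Sum>i<e. smult (c i) (G i)))"
  have "poly F x - poly F (x - 1) = x ^ e" for x
  proof -
    have "(x - 1) ^ Suc e = (\<Sum>i\<le>Suc e. c i * x ^ i)"
      using binomial_ring[of x "-1" "Suc e"] by (simp add: c_def mult_ac)
    also have "\<dots> = (\<Sum>i<e. c i * x ^ i) + c e * x ^ e + c (Suc e) * x ^ Suc e"
      by (simp add: lessThan_Suc_atMost[symmetric])
    also have "\<dots> = (\<Sum>i<e. c i * x ^ i) - of_nat (Suc e) * x ^ e + x ^ Suc e"
      by (simp add: c_def algebra_simps)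
    finally have *: "x ^ Suc e - (x - 1) ^ Suc e + (\<Sum>i<e. c i * x ^ i)
        = of_nat (Suc e) * x ^ e"
      by simp
    have "poly F x - poly F (x - 1) = 1 / of_nat (Suc e) *
       (x ^ Suc e - (x - 1) ^ Suc e + (\<Sum>i<e. c i * (poly (G i) x - poly (G i) (x - 1))))"
      unfolding F_def by (simp add: poly_sum poly_monom sum_subtractf algebra_simps)
    also have "(\<Sum>i<e. c i * (poly (G i) x - poly (G i) (x - 1))) = (\<Sum>i<e. c i * x ^ i)"
      by (rule sum.cong) (use G in auto)
    also have "1 / of_nat (Suc e) * (x ^ Suc e - (x - 1) ^ Suc e + (\<Sum>i<e. c i * x ^ i)) = x ^ e"
      unfolding * by (simp del: of_nat_Suc)
    finally show ?thesis .
  qed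
  then show ?case by blast
qed

text \<open>The zero at -1 fixes the free constant so as to match \<open>signed_sum\<close>, both of
  whose ranges are empty at -1.\<close>

lemma antidifference:
  fixes p :: "complex poly"
  shows "\<exists>F. poly F (-1) = 0 \<and> (\<forall>x. poly F x - poly F (x - 1) = poly p x)"
proof -
  obtain G :: "nat \<Rightarrow> complex poly" where G: "\<And>i x. poly (G i) x - poly (G i) (x - 1) = x ^ i"
    using antidifference_monomial by metis
  define F where "F = (\<Sum>i\<le>degree p. smult (coeff p i) (G i))"
  have "poly F x - poly F (x - 1) = poly p x" for x
  proof -
    have "poly F x - poly F (x - 1)
        = (\<Sum>i\<le>degree p. coeff p i * (poly (G i) x - poly (G i) (x - 1)))"
      by (simp add: F_def poly_sum sum_subtractf right_diff_distrib)
    also have "\<dots> = poly p x" unfolding G by (simp add: poly_altdef)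
    finally show ?thesis .
  qed
  then show ?thesis
    by (intro exI[of _ "F - [:poly F (-1):]"]) simp
qed

text \<open>The sum from 0 to N, with the sign convention that makes it a polynomial in N
  for all integers N when the summand is.\<close>

definition signed_sum :: "(int \<Rightarrow> complex) \<Rightarrow> int \<Rightarrow> complex" where
  "signed_sum f N = (\<Sum>a\<in>{0..N}. f a) - (\<Sum>a\<in>{N+1..-1}. f a)"

lemma signed_sum_step: "signed_sum f N = signed_sum f (N - 1) + f N"
proof (cases "N \<ge> 0")
  case True
  then have "{0..N} = insert N {0..N-1}" by auto
  with True show ?thesis by (simp add: signed_sum_def)
next
  case False
  then have "{N..-1} = insert N {N+1..-1}" by auto
  with False show ?thesis by (simp add: signed_sum_def)
qed

lemma signed_sum_eq:
  assumes "F (-1) = 0" and "\<And>N. F N = F (N - 1) + f N"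
  shows "signed_sum f N = F N"
proof (induction N rule: int_induct[where k = "-1"])
  case base
  then show ?case using assms(1) by (simp add: signed_sum_def)
next
  case (step1 i)
  then show ?case using assms(2)[of "i + 1"] signed_sum_step[of f "i + 1"] by simp
next
  case (step2 i)
  then show ?case using assms(2)[of i] signed_sum_step[of f i] by simp
qed

lemma signed_sum_poly:
  "\<exists>F :: complex poly. \<forall>N. signed_sum (\<lambda>a. poly p (of_int a)) N = poly F (of_int N)"
proof -
  obtain F where F: "poly F (-1) = 0" "\<And>x. poly F x - poly F (x - 1) = poly p x"
    using antidifference by blast
  have "signed_sum (\<lambda>a. poly p (of_int a)) N = poly F (of_int N)" for N
  proof (rule signed_sum_eq)
    show "poly F (of_int (-1)) = 0" using F by simp
    show "poly F (of_int N) = poly F (of_int (N - 1)) + poly p (of_int N)" for N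
      using F(2)[of "of_int N"] by (simp add: algebra_simps)
  qed
  then show ?thesis by blast
qed

text \<open>Horner induction on \<open>S\<close>: its argument N - a contributes a factor N, which
  leaves the sum, and a factor a, which is absorbed into \<open>p\<close>. This is why
  \<open>p\<close> must be arbitrary in the induction.\<close>

lemma signed_sum_convolution:
  "\<exists>F :: complex poly. \<forall>N.
     signed_sum (\<lambda>a. poly p (of_int a) * poly S (of_int (N - a))) N = poly F (of_int N)"
proof (induction S arbitrary: p)
  case 0
  then show ?case by (intro exI[of _ 0]) (simp add: signed_sum_def)
next
  case (pCons c S)
  obtain F1 where F1: "\<And>N. signed_sum (\<lambda>a. poly p (of_int a)) N = poly F1 (of_int N)"
    using signed_sum_poly by blast
  obtain F2 where F2: "\<And>N. signed_sum (\<lambda>a. poly p (of_int a) * poly S (of_int (N - a))) N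
      = poly F2 (of_int N)"
    using pCons.IH by blast
  obtain F3 where F3: "\<And>N. signed_sum (\<lambda>a. poly (pCons 0 p) (of_int a) * poly S (of_int (N - a))) N
      = poly F3 (of_int N)"
    using pCons.IH by blast
  have "signed_sum (\<lambda>a. poly p (of_int a) * poly (pCons c S) (of_int (N - a))) N
     = c * signed_sum (\<lambda>a. poly p (of_int a)) N
       + of_int N * signed_sum (\<lambda>a. poly p (of_int a) * poly S (of_int (N - a))) N
       - signed_sum (\<lambda>a. poly (pCons 0 p) (of_int a) * poly S (of_int (N - a))) N" for N
    by (simp add: signed_sum_def sum_distrib_left sum.distrib sum_subtractf algebra_simps)
  note * = this[unfolded F1 F2 F3]
  show ?case
    by (intro exI[of _ "smult c F1 + pCons 0 F2 - F3"] allI, subst *) simp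
qed

section \<open>Compositions of an integer into nonnegative or into negative parts\<close>

definition nonneg_comp :: "'b set \<Rightarrow> int \<Rightarrow> ('b \<Rightarrow> int) set" where
  "nonneg_comp B N = {k. (\<forall>b. b \<notin> B \<longrightarrow> k b = 0) \<and> (\<forall>b\<in>B. 0 \<le> k b) \<and> sum k B = N}"

definition neg_comp :: "'b set \<Rightarrow> int \<Rightarrow> ('b \<Rightarrow> int) set" where
  "neg_comp B N = {k. (\<forall>b. b \<notin> B \<longrightarrow> k b = 0) \<and> (\<forall>b\<in>B. k b \<le> -1) \<and> sum k B = N}"

lemma finite_nonneg_comp:
  assumes "finite B"
  shows "finite (nonneg_comp B N)"
proof (rule finite_subset)
  show "nonneg_comp B N \<subseteq> {k. \<forall>b. (b \<in> B \<longrightarrow> k b \<in> {0..N}) \<and> (b \<notin> B \<longrightarrow> k b = 0)}"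
  proof
    fix k assume k: "k \<in> nonneg_comp B N"
    have "k b \<le> N" if "b \<in> B" for b
      using member_le_sum[OF that, of k] k assms unfolding nonneg_comp_def by blast
    with k show "k \<in> {k. \<forall>b. (b \<in> B \<longrightarrow> k b \<in> {0..N}) \<and> (b \<notin> B \<longrightarrow> k b = 0)}"
      unfolding nonneg_comp_def by simp
  qed
  show "finite {k. \<forall>b. (b \<in> B \<longrightarrow> k b \<in> {0..N}) \<and> (b \<notin> B \<longrightarrow> k b = 0)}"
    by (rule finite_set_of_finite_funs) (use assms in auto)
qed

text \<open>The reflection t -> -1 - t exchanges the two ranges of parts; it transfers
  finiteness.\<close>

lemma neg_comp_eq:
  "neg_comp B N = (\<lambda>k b. if b \<in> B then - k b - 1 else 0) ` nonneg_comp B (- N - int (card B))"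
  (is "_ = ?f ` _")
proof -
  have s: "sum (?f k) B = - sum k B - int (card B)" for k
    by (simp add: sum_subtractf sum_negf cong: sum.cong)
  show ?thesis
  proof (intro equalityI subsetI)
    fix k assume k: "k \<in> neg_comp B N"
    have "k = ?f (?f k)" using k by (simp add: neg_comp_def fun_eq_iff)
    moreover have "?f k \<in> nonneg_comp B (- N - int (card B))"
      using k s[of k] by (fastforce simp: neg_comp_def nonneg_comp_def)
    ultimately show "k \<in> ?f ` nonneg_comp B (- N - int (card B))" by (rule image_eqI)
  next
    fix k assume "k \<in> ?f ` nonneg_comp B (- N - int (card B))"
    then obtain l where l: "l \<in> nonneg_comp B (- N - int (card B))" "k = ?f l" by (rule imageE)
    show "k \<in> neg_comp B N"
      using l(1) s[of l] unfolding l(2) by (simp add: neg_comp_def nonneg_comp_def)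
  qed
qed

lemma finite_neg_comp: "finite B \<Longrightarrow> finite (neg_comp B N)"
  by (simp add: neg_comp_eq finite_nonneg_comp)

lemma nonneg_comp_empty:
  assumes "N < 0"
  shows "nonneg_comp B N = {}"
proof -
  have "0 \<le> N" if "k \<in> nonneg_comp B N" for k
    using that sum_nonneg[of B k] by (simp add: nonneg_comp_def)
  with assms show ?thesis by fastforce
qed

lemma neg_comp_empty:
  assumes "finite B" "B \<noteq> {}" "N \<ge> 0" 
  shows "neg_comp B N = {}"
proof -
  have "N < 0" if "k \<in> neg_comp B N" for k
    using that sum_strict_mono[OF assms(1,2), of k "\<lambda>_. 0"] by (fastforce simp: neg_comp_def)
  with assms(3) show ?thesis by fastforce
qed

lemma sum_nonneg_comp_insert:
  assumes "finite B" "j \<notin> B"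
  shows "(\<Sum>k\<in>nonneg_comp (insert j B) N. \<Prod>b\<in>insert j B. f b (k b))
    = (\<Sum>a\<in>{0..N}. f j a * (\<Sum>k\<in>nonneg_comp B (N - a). \<Prod>b\<in>B. (f b (k b) :: complex)))"
proof -
  have "(\<Sum>a\<in>{0..N}. f j a * (\<Sum>k\<in>nonneg_comp B (N - a). \<Prod>b\<in>B. f b (k b)))
    = (\<Sum>(a,k)\<in>(SIGMA a:{0..N}. nonneg_comp B (N - a)). f j a * (\<Prod>b\<in>B. f b (k b)))"
    by (simp add: sum_distrib_left sum.Sigma finite_nonneg_comp assms)
  also have "\<dots> = (\<Sum>k\<in>nonneg_comp (insert j B) N. \<Prod>b\<in>insert j B. f b (k b))"
  proof (rule sum.reindex_bij_witness[where i = "\<lambda>k. (k j, k(j := 0))" and j = "\<lambda>(a,k). k(j := a)"])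
    fix ak assume "ak \<in> (SIGMA a:{0..N}. nonneg_comp B (N - a))"
    then obtain a k where ak: "ak = (a,k)" "0 \<le> a" "k \<in> nonneg_comp B (N - a)" by auto
    have s: "sum (k(j := a)) B = sum k B" using assms by (intro sum.cong) auto
    have p: "(\<Prod>b\<in>B. f b ((k(j := a)) b)) = (\<Prod>b\<in>B. f b (k b))"
      using assms by (intro prod.cong) auto
    show "((case ak of (a, k) \<Rightarrow> k(j := a)) j, (case ak of (a, k) \<Rightarrow> k(j := a))(j := 0)) = ak"
      using ak assms by (auto simp: nonneg_comp_def)
    show "(case ak of (a, k) \<Rightarrow> k(j := a)) \<in> nonneg_comp (insert j B) N"
      using ak assms s by (auto simp: nonneg_comp_def)
    show "(\<Prod>b\<in>insert j B. f b ((case ak of (a, k) \<Rightarrow> k(j := a)) b))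
        = (case ak of (a, k) \<Rightarrow> f j a * (\<Prod>b\<in>B. f b (k b)))"
      using ak assms p by simp
  next
    fix k assume k: "k \<in> nonneg_comp (insert j B) N"
    have s: "sum (k(j := 0)) B = sum k B" using assms by (intro sum.cong) auto
    have "0 \<le> sum k B" using k by (intro sum_nonneg) (auto simp: nonneg_comp_def)
    then show "(k j, k(j := 0)) \<in> (SIGMA a:{0..N}. nonneg_comp B (N - a))"
      using k assms s by (auto simp: nonneg_comp_def)
  qed auto
  finally show ?thesis ..
qed

text \<open>Since \<open>B\<close> is nonempty, the remaining parts have negative sum N - a. This
  forces a > N and gives exactly the range subtracted in \<open>signed_sum\<close>.\<close>

lemma sum_neg_comp_insert:
  assumes "finite B" "B \<noteq> {}" "j \<notin> B"
  shows "(\<Sum>k\<in>neg_comp (insert j B) N. \<Prod>b\<in>insert j B. f b (k b))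
    = (\<Sum>a\<in>{N+1..-1}. f j a * (\<Sum>k\<in>neg_comp B (N - a). \<Prod>b\<in>B. (f b (k b) :: complex)))"
proof -
  have "(\<Sum>a\<in>{N+1..-1}. f j a * (\<Sum>k\<in>neg_comp B (N - a). \<Prod>b\<in>B. f b (k b)))
    = (\<Sum>(a,k)\<in>(SIGMA a:{N+1..-1}. neg_comp B (N - a)). f j a * (\<Prod>b\<in>B. f b (k b)))"
    by (simp add: sum_distrib_left sum.Sigma finite_neg_comp assms)
  also have "\<dots> = (\<Sum>k\<in>neg_comp (insert j B) N. \<Prod>b\<in>insert j B. f b (k b))"
  proof (rule sum.reindex_bij_witness[where i = "\<lambda>k. (k j, k(j := 0))" and j = "\<lambda>(a,k). k(j := a)"])
    fix ak assume "ak \<in> (SIGMA a:{N+1..-1}. neg_comp B (N - a))"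
    then obtain a k where ak: "ak = (a,k)" "a \<le> -1" "k \<in> neg_comp B (N - a)" by auto
    have s: "sum (k(j := a)) B = sum k B" using assms by (intro sum.cong) auto
    have p: "(\<Prod>b\<in>B. f b ((k(j := a)) b)) = (\<Prod>b\<in>B. f b (k b))"
      using assms by (intro prod.cong) auto
    show "((case ak of (a, k) \<Rightarrow> k(j := a)) j, (case ak of (a, k) \<Rightarrow> k(j := a))(j := 0)) = ak"
      using ak assms by (auto simp: neg_comp_def)
    show "(case ak of (a, k) \<Rightarrow> k(j := a)) \<in> neg_comp (insert j B) N"
      using ak assms s by (auto simp: neg_comp_def)
    show "(\<Prod>b\<in>insert j B. f b ((case ak of (a, k) \<Rightarrow> k(j := a)) b))
        = (case ak of (a, k) \<Rightarrow> f j a * (\<Prod>b\<in>B. f b (k b)))"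
      using ak assms p by simp
  next
    fix k assume k: "k \<in> neg_comp (insert j B) N"
    have s: "sum (k(j := 0)) B = sum k B" using assms by (intro sum.cong) auto
    have "k(j := 0) \<in> neg_comp B (sum k B)"
      using k s assms by (auto simp: neg_comp_def)
    then have "sum k B < 0" using neg_comp_empty[of B "sum k B"] assms by force
    then show "(k j, k(j := 0)) \<in> (SIGMA a:{N+1..-1}. neg_comp B (N - a))"
      using k assms s by (auto simp: neg_comp_def)
  qed auto
  finally show ?thesis ..
qed

text \<open>At most one of the two sums is nonempty: the first for N nonnegative, the second for N
  negative.\<close>

definition comp_sum :: "'b set \<Rightarrow> (('b \<Rightarrow> int) \<Rightarrow> complex) \<Rightarrow> int \<Rightarrow> complex" where
  "comp_sum B \<psi> N = (\<Sum>k\<in>nonneg_comp B N. \<psi> k) + (-1) ^ (card B - 1) * (\<Sum>k\<in>neg_comp B N. \<psi> k)"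

text \<open>Splitting off one part is a convolution with the polynomial of the smaller set. On
  {0..N} the argument N - a is nonnegative and only nonnegative compositions contribute; on
  {N+1..-1} it is negative and only negative ones do. The minus sign of \<open>signed_sum\<close> on
  the second range accounts for the sign gained with each part.\<close>

lemma comp_sum_prod_poly:
  fixes p :: "'b \<Rightarrow> complex poly"
  assumes "finite B" "B \<noteq> {}"
  shows "\<exists>S. \<forall>N. comp_sum B (\<lambda>k. \<Prod>b\<in>B. poly (p b) (of_int (k b))) N = poly S (of_int N)"
  using assms
proof (induction rule: finite_ne_induct)
  case (singleton j)
  have "comp_sum {j} (\<lambda>k. \<Prod>b\<in>{j}. poly (p b) (of_int (k b))) N = poly (p j) (of_int N)" for N
  proof -
    define d where "d = (\<lambda>b. if b = j then N else 0)"
    have "nonneg_comp {j} N = (if N \<ge> 0 then {d} else {})"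
      by (auto simp: nonneg_comp_def d_def fun_eq_iff)
    moreover have "neg_comp {j} N = (if N \<ge> 0 then {} else {d})"
      by (auto simp: neg_comp_def d_def fun_eq_iff)
    ultimately show ?thesis by (simp add: comp_sum_def d_def)
  qed
  then show ?case by blast
next
  case (insert j B)
  define f where "f b a = poly (p b) (of_int a)" for b a
  from insert obtain S where S: "\<And>N. comp_sum B (\<lambda>k. \<Prod>b\<in>B. f b (k b)) N = poly S (of_int N)"
    by (auto simp: f_def)
  obtain F where F: "\<And>N. signed_sum (\<lambda>a. f j a * poly S (of_int (N - a))) N = poly F (of_int N)"
    unfolding f_def using signed_sum_convolution by blast
  have card: "card B \<noteq> 0" using insert by simp
  have sg: "(-1) ^ card B = - ((-1) ^ (card B - 1) :: complex)"
    using card by (cases "card B") auto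
  have "comp_sum (insert j B) (\<lambda>k. \<Prod>b\<in>insert j B. f b (k b)) N = poly F (of_int N)" for N
  proof -
    define U where "U a = (\<Sum>k\<in>nonneg_comp B (N - a). \<Prod>b\<in>B. f b (k b))" for a
    define V where "V a = (\<Sum>k\<in>neg_comp B (N - a). \<Prod>b\<in>B. f b (k b))" for a
    have S': "poly S (of_int (N - a)) = U a + (-1) ^ (card B - 1) * V a" for a
      using S[of "N - a"] by (simp add: comp_sum_def U_def V_def)
    have "U a = 0" if "a > N" for a using that by (simp add: U_def nonneg_comp_empty)
    moreover have "V a = 0" if "a \<le> N" for a
      using that insert by (simp add: V_def neg_comp_empty)
    ultimately have UV: "a > N \<Longrightarrow> U a = 0" "a \<le> N \<Longrightarrow> V a = 0" for a by auto
    have "comp_sum (insert j B) (\<lambda>k. \<Prod>b\<in>insert j B. f b (k b)) N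
      = (\<Sum>a\<in>{0..N}. f j a * U a) - (-1) ^ (card B - 1) * (\<Sum>a\<in>{N+1..-1}. f j a * V a)"
      using insert card sg sum_nonneg_comp_insert[of B j f N] sum_neg_comp_insert[of B j f N]
      unfolding comp_sum_def U_def V_def by simp
    also have "\<dots> = signed_sum (\<lambda>a. f j a * poly S (of_int (N - a))) N"
      unfolding signed_sum_def S' sum_distrib_left
      by (intro arg_cong2[where f = "(-)"] sum.cong) (auto simp: UV)
    finally show ?thesis unfolding F .
  qed
  then show ?case by (auto simp: f_def)
qed

section \<open>Polynomial weights as combinations of products of one-variable polynomials\<close>

inductive polyfun :: "('a::euclidean_space \<Rightarrow> complex) \<Rightarrow> bool" where
  const: "polyfun (\<lambda>_. c)"
| linear: "linear f \<Longrightarrow> polyfun (\<lambda>x. complex_of_real (f x))"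
| add: "polyfun f \<Longrightarrow> polyfun g \<Longrightarrow> polyfun (\<lambda>x. f x + g x)"
| mult: "polyfun f \<Longrightarrow> polyfun g \<Longrightarrow> polyfun (\<lambda>x. f x * g x)"

lemma polyfun_sum: "finite A \<Longrightarrow> (\<And>a. a \<in> A \<Longrightarrow> polyfun (f a)) \<Longrightarrow> polyfun (\<lambda>x. \<Sum>a\<in>A. f a x)"
  by (induction A rule: finite_induct) (auto intro: polyfun.intros)

lemma polyfun_prod: "finite A \<Longrightarrow> (\<And>a. a \<in> A \<Longrightarrow> polyfun (f a)) \<Longrightarrow> polyfun (\<lambda>x. \<Prod>a\<in>A. f a x)"
  by (induction A rule: finite_induct) (auto intro: polyfun.intros)

lemma polyfun_power: "polyfun f \<Longrightarrow> polyfun (\<lambda>x. f x ^ n)"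
  by (induction n) (auto intro: polyfun.intros)

lemma polyfun_uminus: "polyfun f \<Longrightarrow> polyfun (\<lambda>x. f (- x))"
proof (induction rule: polyfun.induct)
  case (linear f)
  then have "linear (\<lambda>x. f (- x))"
    by (intro linear_compose[of uminus f, unfolded o_def]) (auto simp: linear_iff)
  then show ?case by (rule polyfun.linear)
qed (auto intro: polyfun.intros)

text \<open>Convolution handles summands that are products over the parts, and
  \<open>comp_sum\<close> is linear in its summand. The linear span of such products is thus the
  natural class; being closed under multiplication, it contains every polynomial in the
  parts.\<close>

inductive prod_poly_span :: "'b set \<Rightarrow> (('b \<Rightarrow> int) \<Rightarrow> complex) \<Rightarrow> bool" for B where
  prod: "prod_poly_span B (\<lambda>k. \<Prod>b\<in>B. poly (p b) (of_int (k b)))"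
| add: "prod_poly_span B f \<Longrightarrow> prod_poly_span B g \<Longrightarrow> prod_poly_span B (\<lambda>k. f k + g k)"
| scale: "prod_poly_span B f \<Longrightarrow> prod_poly_span B (\<lambda>k. c * f k)"

lemma prod_poly_span_mult:
  assumes "prod_poly_span B f" "prod_poly_span B g"
  shows "prod_poly_span B (\<lambda>k. f k * g k)"
  using assms
proof (induction arbitrary: g rule: prod_poly_span.induct)
  case (prod p)
  from prod show ?case
  proof (induction rule: prod_poly_span.induct)
    case (prod r)
    show ?case
      using prod_poly_span.prod[of B "\<lambda>b. p b * r b"] by (simp add: prod.distrib)
  next
    case (add f g)
    then show ?case using prod_poly_span.add by (auto simp: distrib_left)
  next
    case (scale f c)
    then show ?case using prod_poly_span.scale[OF scale.IH, of c] by (simp add: mult_ac)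
  qed
next
  case (add f1 f2)
  then show ?case
    using prod_poly_span.add[OF add.IH(1)[OF add.prems] add.IH(2)[OF add.prems]]
    by (simp add: distrib_right)
next
  case (scale f c)
  then show ?case using prod_poly_span.scale[OF scale.IH[OF scale.prems], of c] by (simp add: mult_ac)
qed

lemma prod_poly_span_const: "finite B \<Longrightarrow> prod_poly_span B (\<lambda>_. c)"
  using prod_poly_span.scale[OF prod_poly_span.prod[of B "\<lambda>_. 1"], of c] by simp

lemma prod_poly_span_coord:
  assumes "finite B" "j \<in> B"
  shows "prod_poly_span B (\<lambda>k. of_int (k j))"
proof -
  have "(\<Prod>b\<in>B. poly (if b = j then [:0,1:] else 1) (of_int (k b) :: complex)) = of_int (k j)" for k
    using assms by (subst prod.remove[of _ j]) auto
  then show ?thesis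
    using prod_poly_span.prod[of B "\<lambda>b. if b = j then [:0,1:] else 1"] by simp
qed

lemma prod_poly_span_sum:
  "finite A \<Longrightarrow> finite B \<Longrightarrow> (\<And>a. a \<in> A \<Longrightarrow> prod_poly_span B (f a)) \<Longrightarrow> prod_poly_span B (\<lambda>k. \<Sum>a\<in>A. f a k)"
  by (induction A rule: finite_induct) (auto intro: prod_poly_span.add prod_poly_span_const)

lemma polyfun_prod_poly_span:
  assumes "polyfun \<phi>" "finite B"
  shows "prod_poly_span B (\<lambda>k. \<phi> (p + (\<Sum>b\<in>B. of_int (k b) *\<^sub>R v b)))"
  using assms(1)
proof (induction rule: polyfun.induct)
  case (linear f)
  have "complex_of_real (f (p + (\<Sum>b\<in>B. of_int (k b) *\<^sub>R v b)))
      = complex_of_real (f p) + (\<Sum>b\<in>B. complex_of_real (f (v b)) * of_int (k b))" for k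
    using linear by (simp add: linear_add linear_sum linear_cmul mult_ac)
  then show ?case using assms(2)
    by (auto intro!: prod_poly_span.add prod_poly_span_sum prod_poly_span_const
        prod_poly_span.scale prod_poly_span_coord)
qed (use assms(2) in \<open>auto intro: prod_poly_span.add prod_poly_span_mult prod_poly_span_const\<close>)

lemma comp_sum_poly:
  assumes "finite B" "B \<noteq> {}" "prod_poly_span B \<psi>"
  shows "\<exists>S. \<forall>N. comp_sum B \<psi> N = poly S (of_int N)"
  using assms(3)
proof (induction rule: prod_poly_span.induct)
  case (prod p)
  then show ?case using comp_sum_prod_poly assms by blast
next
  case (add f g)
  then obtain S T where "\<And>N. comp_sum B f N = poly S (of_int N)" "\<And>N. comp_sum B g N = poly T (of_int N)"
    by blast
  moreover have "comp_sum B (\<lambda>k. f k + g k) N = comp_sum B f N + comp_sum B g N" for N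
    by (simp add: comp_sum_def sum.distrib distrib_left)
  ultimately show ?case
    by (intro exI[of _ "S + T"]) simp
next
  case (scale f c)
  then obtain S where "\<And>N. comp_sum B f N = poly S (of_int N)" by blast
  moreover have "comp_sum B (\<lambda>k. c * f k) N = c * comp_sum B f N" for N
    by (simp add: comp_sum_def distrib_left flip: sum_distrib_left)
  ultimately show ?case
    by (intro exI[of _ "smult c S"])
       simp
qed

section \<open>Reciprocity for half-open simplices\<close>

text \<open>The group laws allow shifting by integer combinations of vertices; local finiteness
  makes the sums over dilates finite.\<close>

definition discrete_subgroup :: "'a::euclidean_space set \<Rightarrow> bool" where
  "discrete_subgroup M \<longleftrightarrow> 0 \<in> M \<and> (\<forall>x\<in>M. \<forall>y\<in>M. x + y \<in> M) \<and> (\<forall>x\<in>M. - x \<in> M)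
     \<and> (\<forall>S. bounded S \<longrightarrow> finite (M \<inter> S))"

lemma discrete_subgroup_sum:
  assumes "discrete_subgroup M" "\<And>a. a \<in> A \<Longrightarrow> f a \<in> M"
  shows "sum f A \<in> M"
  using assms by (induction A rule: infinite_finite_induct) (auto simp: discrete_subgroup_def)

lemma discrete_subgroup_scale:
  assumes "discrete_subgroup M" "x \<in> M"
  shows "of_int k *\<^sub>R x \<in> M"
proof -
  have *: "of_nat n *\<^sub>R x \<in> M" for n
    using assms by (induction n) (auto simp: discrete_subgroup_def scaleR_add_left)
  show ?thesis
  proof (cases k)
    case (neg n)
    have "of_int k *\<^sub>R x = - (of_nat (Suc n) *\<^sub>R x)" unfolding neg by (simp add: algebra_simps)
    then show ?thesis using *[of "Suc n"] assms(1) unfolding discrete_subgroup_def by metis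
  qed (use * in simp)
qed

lemma discrete_subgroup_diff:
  "discrete_subgroup M \<Longrightarrow> x \<in> M \<Longrightarrow> y \<in> M \<Longrightarrow> x - y \<in> M"
  unfolding discrete_subgroup_def by (metis add_uminus_conv_diff)

text \<open>The coefficient sum is left free: families with sum q describe the q-fold dilate, so the
  sum acts as a height in the cone over \<open>B\<close>.\<close>

definition lin_comb :: "'a::real_vector set \<Rightarrow> ('a \<Rightarrow> real) \<Rightarrow> 'a" where
  "lin_comb B u = (\<Sum>b\<in>B. u b *\<^sub>R b)"

lemma lin_comb_add: "lin_comb B (\<lambda>b. u b + v b) = lin_comb B u + lin_comb B v"
  by (simp add: lin_comb_def scaleR_add_left sum.distrib)

lemma lin_comb_diff: "lin_comb B (\<lambda>b. u b - v b) = lin_comb B u - lin_comb B v"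
  by (simp add: lin_comb_def scaleR_diff_left sum_subtractf)

lemma lin_comb_uminus: "lin_comb B (\<lambda>b. - u b) = - lin_comb B u"
  by (simp add: lin_comb_def sum_negf)

lemma lin_comb_scale: "lin_comb B (\<lambda>b. c * u b) = c *\<^sub>R lin_comb B u"
  by (simp add: lin_comb_def scaleR_sum_right)

lemma lin_comb_cong: "(\<And>b. b \<in> B \<Longrightarrow> u b = v b) \<Longrightarrow> lin_comb B u = lin_comb B v"
  by (simp add: lin_comb_def)

text \<open>The vertices may be linearly dependent, for instance when one of them is the origin.
  Equal coefficient sums make the difference of the two families an affine relation, which must be
  trivial.\<close>

lemma affine_independent_coords_unique:
  assumes "\<not> affine_dependent B" "finite B"
    and "sum u B = sum v B" "lin_comb B u = lin_comb B v" "b \<in> B"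
  shows "u b = v b"
proof -
  have "sum (\<lambda>b. u b - v b) B = 0" "(\<Sum>b\<in>B. (u b - v b) *\<^sub>R b) = 0"
    using assms(3,4) by (simp_all add: sum_subtractf lin_comb_def scaleR_diff_left)
  then show ?thesis
    using assms(1,2,5) affine_dependent_explicit_finite[of B] by fastforce
qed

definition half_open_simplex :: "'a::real_vector set \<Rightarrow> 'a set \<Rightarrow> 'a set" where
  "half_open_simplex B J = {lin_comb B u | u. sum u B = 1 \<and> (\<forall>b\<in>B. 0 \<le> u b \<and> (b \<in> J \<longrightarrow> 0 < u b))}"

text \<open>Unit cells are [0,1) in the directions outside J and (0,1] in the directions in J.\<close>

definition cell_index :: "'b set \<Rightarrow> 'b \<Rightarrow> real \<Rightarrow> int" where
  "cell_index J b t = (if b \<in> J then \<lceil>t\<rceil> - 1 else \<lfloor>t\<rfloor>)"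

lemma cell_index_add_int: "cell_index J b (t + of_int k) = cell_index J b t + k"
  and cell_index_diff_int: "cell_index J b (t - of_int k) = cell_index J b t - k"
  by (auto simp: cell_index_def)

lemma cell_index_nonneg: "0 \<le> cell_index J b t \<longleftrightarrow> 0 \<le> t \<and> (b \<in> J \<longrightarrow> 0 < t)"
  unfolding cell_index_def by (auto; linarith)

text \<open>Under t -> -t the strict inequality moves from the directions in \<open>J\<close> to
  those outside. This is the source of the exchange of \<open>J\<close> and \<open>B - J\<close> in
  reciprocity.\<close>

lemma cell_index_neg: "cell_index J b t \<le> -1 \<longleftrightarrow> 0 \<le> - t \<and> (b \<notin> J \<longrightarrow> 0 < - t)"
  unfolding cell_index_def by (auto; linarith)

lemma cell_index_eq_0: "cell_index J b t = 0 \<Longrightarrow> 0 \<le> t \<and> t \<le> 1"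
  unfolding cell_index_def by (auto split: if_splits; linarith)

text \<open>These are the points of M in the half-open fundamental parallelepiped of the cone over
  \<open>B\<close>, restricted to integral height \<open>sum c B\<close>.\<close>

definition cell_points :: "'a::real_vector set \<Rightarrow> 'a set \<Rightarrow> 'a set \<Rightarrow> ('a \<Rightarrow> real) set" where
  "cell_points M B J = {c. (\<forall>b. b \<notin> B \<longrightarrow> c b = 0) \<and> lin_comb B c \<in> M \<and> sum c B \<in> \<int>
     \<and> (\<forall>b\<in>B. cell_index J b (c b) = 0)}"

text \<open>A family is determined by its point together with its height. The points lie in a
  bounded part of \<open>M\<close>, and the heights are integers between 0 and
  \<open>card B\<close>.\<close>

lemma finite_cell_points:
  assumes "discrete_subgroup M" "finite B" "\<not> affine_dependent B"
  shows "finite (cell_points M B J)"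
proof (rule inj_on_finite)
  let ?g = "\<lambda>c. (lin_comb B c, sum c B)"
  let ?R = "\<Sum>b\<in>B. norm b"
  show "inj_on ?g (cell_points M B J)"
  proof (rule inj_onI)
    fix c d assume "c \<in> cell_points M B J" "d \<in> cell_points M B J" "?g c = ?g d"
    then have "c b = d b" for b
      using affine_independent_coords_unique[OF assms(3,2), of c d b]
      by (cases "b \<in> B") (auto simp: cell_points_def)
    then show "c = d" by blast
  qed
  show "?g ` cell_points M B J \<subseteq> (M \<inter> cball 0 ?R) \<times> of_int ` {0..int (card B)}"
  proof (clarsimp, intro conjI)
    fix c assume c: "c \<in> cell_points M B J"
    then show "lin_comb B c \<in> M" by (simp add: cell_points_def)
    have c01: "0 \<le> c b" "c b \<le> 1" if "b \<in> B" for b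
      using c that cell_index_eq_0[of J b "c b"] by (auto simp: cell_points_def)
    have "norm (lin_comb B c) \<le> (\<Sum>b\<in>B. norm (c b *\<^sub>R b))"
      unfolding lin_comb_def by (rule norm_sum)
    also have "\<dots> \<le> ?R"
      using c01 by (intro sum_mono) (auto intro: mult_left_le_one_le)
    finally show "norm (lin_comb B c) \<le> ?R" .
    obtain k where k: "sum c B = of_int k" using c by (auto simp: cell_points_def elim: Ints_cases)
    have "0 \<le> sum c B" "sum c B \<le> of_nat (card B)"
      using c01 sum_bounded_above[of B c 1] by (auto intro: sum_nonneg)
    then have "k \<in> {0..int (card B)}" unfolding k by (simp; linarith)
    then show "sum c B \<in> real_of_int ` {0..int (card B)}" using k by blast
  qed
  show "finite ((M \<inter> cball 0 ?R) \<times> real_of_int ` {0..int (card B)})"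
    using assms(1) by (simp add: discrete_subgroup_def)
qed

text \<open>Every family \<mu> is uniquely a cell point plus an integral family, the latter being
  given by \<open>cell_index\<close>. Keeping the condition on the indices as a predicate
  \<open>Q\<close> lets the same bijection serve both nonnegative and negative indices.\<close>

lemma sum_cell_decomposition:
  fixes \<phi> :: "'a::euclidean_space \<Rightarrow> complex" and N :: int and Q :: "int \<Rightarrow> bool"
  assumes M: "discrete_subgroup M" and B: "finite B" "\<not> affine_dependent B" "B \<subseteq> M"
    and fin: "\<And>N. finite {k. (\<forall>b. b \<notin> B \<longrightarrow> k b = 0) \<and> (\<forall>b\<in>B. Q (k b)) \<and> sum k B = N}"
  shows "(\<Sum>\<mu>\<in>{\<mu>. (\<forall>b. b \<notin> B \<longrightarrow> \<mu> b = 0) \<and> lin_comb B \<mu> \<in> M \<and> sum \<mu> B = of_int N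
              \<and> (\<forall>b\<in>B. Q (cell_index J b (\<mu> b)))}. \<phi> (lin_comb B \<mu>))
    = (\<Sum>c\<in>cell_points M B J.
        \<Sum>k\<in>{k. (\<forall>b. b \<notin> B \<longrightarrow> k b = 0) \<and> (\<forall>b\<in>B. Q (k b)) \<and> sum k B = N - \<lfloor>sum c B\<rfloor>}.
          \<phi> (lin_comb B c + (\<Sum>b\<in>B. of_int (k b) *\<^sub>R b)))"
    (is "(\<Sum>\<mu>\<in>?L. _) = (\<Sum>c\<in>?C. \<Sum>k\<in>?K c. ?f c k)")
proof -
  have "(\<Sum>c\<in>?C. \<Sum>k\<in>?K c. ?f c k) = (\<Sum>(c,k)\<in>(SIGMA c:?C. ?K c). ?f c k)"
    using finite_cell_points[OF M B(1,2)] fin by (intro sum.Sigma) auto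
  also have "\<dots> = (\<Sum>\<mu>\<in>?L. \<phi> (lin_comb B \<mu>))"
  proof (rule sum.reindex_bij_witness[where
        i = "\<lambda>\<mu>. (\<lambda>b. if b \<in> B then \<mu> b - of_int (cell_index J b (\<mu> b)) else 0,
                  \<lambda>b. if b \<in> B then cell_index J b (\<mu> b) else 0)"
        and j = "\<lambda>(c,k) b. c b + of_int (k b)"])
    fix ck assume "ck \<in> (SIGMA c:?C. ?K c)"
    then obtain c k where ck: "ck = (c,k)" "c \<in> ?C" "k \<in> ?K c" by auto
    have lin: "lin_comb B (\<lambda>b. c b + of_int (k b)) = lin_comb B c + (\<Sum>b\<in>B. of_int (k b) *\<^sub>R b)"
      by (simp add: lin_comb_add) (simp add: lin_comb_def)
    have "(\<Sum>b\<in>B. of_int (k b) *\<^sub>R b) \<in> M"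
      using M B(3) by (intro discrete_subgroup_sum discrete_subgroup_scale) auto
    with ck(2) have inM: "lin_comb B (\<lambda>b. c b + of_int (k b)) \<in> M"
      using M unfolding lin by (auto simp: cell_points_def discrete_subgroup_def)
    obtain h where h: "sum c B = of_int h" using ck(2) by (auto simp: cell_points_def elim: Ints_cases)
    have "(\<Sum>b\<in>B. c b + of_int (k b)) = of_int N"
      using ck(3) h by (simp add: sum.distrib flip: of_int_sum)
    with ck inM show "(case ck of (c,k) \<Rightarrow> \<lambda>b. c b + of_int (k b)) \<in> ?L"
      by (auto simp: cell_points_def cell_index_add_int)
    show "\<phi> (lin_comb B (case ck of (c,k) \<Rightarrow> \<lambda>b. c b + of_int (k b))) = (case ck of (c,k) \<Rightarrow> ?f c k)"
      by (simp add: ck(1) lin)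
    show "(\<lambda>b. if b \<in> B then (case ck of (c,k) \<Rightarrow> \<lambda>b. c b + of_int (k b)) b
             - of_int (cell_index J b ((case ck of (c,k) \<Rightarrow> \<lambda>b. c b + of_int (k b)) b)) else 0,
           \<lambda>b. if b \<in> B then cell_index J b ((case ck of (c,k) \<Rightarrow> \<lambda>b. c b + of_int (k b)) b) else 0) = ck"
      using ck by (auto simp: cell_points_def cell_index_add_int fun_eq_iff)
  next
    fix \<mu> assume \<mu>: "\<mu> \<in> ?L"
    define k where "k = (\<lambda>b. if b \<in> B then cell_index J b (\<mu> b) else 0)"
    define c where "c = (\<lambda>b. if b \<in> B then \<mu> b - of_int (cell_index J b (\<mu> b)) else 0)"
    have c_eq: "c = (\<lambda>b. \<mu> b - of_int (k b))"
      using \<mu> by (auto simp: c_def k_def fun_eq_iff)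
    then show "(case (c, k) of (c,k) \<Rightarrow> \<lambda>b. c b + of_int (k b)) = \<mu>" by simp
    have "(\<Sum>b\<in>B. of_int (k b) *\<^sub>R b) \<in> M"
      using M B(3) by (intro discrete_subgroup_sum discrete_subgroup_scale) auto
    moreover have "lin_comb B c = lin_comb B \<mu> - (\<Sum>b\<in>B. of_int (k b) *\<^sub>R b)"
      unfolding c_eq lin_comb_diff by (simp add: lin_comb_def)
    ultimately have "lin_comb B c \<in> M" using \<mu> discrete_subgroup_diff[OF M] by auto
    moreover have sc: "sum c B = of_int (N - sum k B)"
      unfolding c_eq using \<mu> by (simp add: sum_subtractf)
    ultimately have "c \<in> ?C"
      by (auto simp: cell_points_def c_def cell_index_diff_int)
    moreover have "k \<in> ?K c" using \<mu> unfolding sc floor_of_int by (simp add: k_def)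
    ultimately show "(c, k) \<in> (SIGMA c:?C. ?K c)" by blast
  qed
  finally show ?thesis ..
qed

lemma mem_scaled_image:
  fixes q :: real and X :: "'a::real_vector set"
  assumes "q \<noteq> 0"
  shows "m \<in> (\<lambda>x. q *\<^sub>R x) ` X \<longleftrightarrow> (1/q) *\<^sub>R m \<in> X"
proof
  assume "(1/q) *\<^sub>R m \<in> X"
  moreover have "m = q *\<^sub>R ((1/q) *\<^sub>R m)" using assms by simp
  ultimately show "m \<in> (\<lambda>x. q *\<^sub>R x) ` X" by (rule image_eqI[rotated])
qed (use assms in auto)

lemma sum_over_half_open_simplex:
  fixes \<phi> :: "'a::euclidean_space \<Rightarrow> complex"
  assumes B: "finite B" "\<not> affine_dependent B" and q: "q > 0"
  shows "(\<Sum>m\<in>M \<inter> (\<lambda>x. q *\<^sub>R x) ` half_open_simplex B J. \<phi> m)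
    = (\<Sum>\<nu>\<in>{\<nu>. (\<forall>b. b \<notin> B \<longrightarrow> \<nu> b = 0) \<and> lin_comb B \<nu> \<in> M \<and> sum \<nu> B = q
         \<and> (\<forall>b\<in>B. 0 \<le> \<nu> b \<and> (b \<in> J \<longrightarrow> 0 < \<nu> b))}. \<phi> (lin_comb B \<nu>))"
    (is "_ = sum _ ?W")
proof -
  have "inj_on (lin_comb B) ?W"
  proof (rule inj_onI)
    fix c d assume "c \<in> ?W" "d \<in> ?W" "lin_comb B c = lin_comb B d"
    then have "c b = d b" for b
      using affine_independent_coords_unique[OF B(2,1), of c d b] by (cases "b \<in> B") auto
    then show "c = d" by blast
  qed
  moreover have "lin_comb B ` ?W = M \<inter> (\<lambda>x. q *\<^sub>R x) ` half_open_simplex B J"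
  proof (intro equalityI subsetI)
    fix m assume "m \<in> lin_comb B ` ?W"
    then obtain \<nu> where \<nu>: "\<nu> \<in> ?W" "m = lin_comb B \<nu>" by blast
    define u where "u = (\<lambda>b. (1/q) * \<nu> b)"
    have "sum u B = 1"
      using \<nu>(1) q unfolding u_def by (simp flip: sum_divide_distrib)
    moreover have "\<forall>b\<in>B. 0 \<le> u b \<and> (b \<in> J \<longrightarrow> 0 < u b)"
      using \<nu>(1) q by (simp add: u_def)
    ultimately have "lin_comb B u \<in> half_open_simplex B J"
      unfolding half_open_simplex_def by blast
    moreover have "lin_comb B u = (1/q) *\<^sub>R m" unfolding \<nu>(2) u_def by (rule lin_comb_scale)
    ultimately show "m \<in> M \<inter> (\<lambda>x. q *\<^sub>R x) ` half_open_simplex B J"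
      using \<nu> q by (simp add: mem_scaled_image)
  next
    fix m assume m: "m \<in> M \<inter> (\<lambda>x. q *\<^sub>R x) ` half_open_simplex B J"
    then obtain u where u: "m = q *\<^sub>R lin_comb B u" "sum u B = 1"
      "\<forall>b\<in>B. 0 \<le> u b \<and> (b \<in> J \<longrightarrow> 0 < u b)"
      by (auto simp: half_open_simplex_def)
    define \<nu> where "\<nu> = (\<lambda>b. if b \<in> B then q * u b else 0)"
    have "m = lin_comb B \<nu>"
      unfolding u(1) lin_comb_scale[symmetric] by (rule lin_comb_cong) (simp add: \<nu>_def)
    moreover have "sum \<nu> B = q"
      using u(2) by (simp add: \<nu>_def flip: sum_distrib_left)
    ultimately show "m \<in> lin_comb B ` ?W"
      using m u(3) q by (intro image_eqI[of _ _ \<nu>]) (auto simp: \<nu>_def)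
  qed
  ultimately show ?thesis
    by (metis (no_types, lifting) sum.reindex_cong)
qed

text \<open>For each cell point, the sum over integral shifts is a \<open>comp_sum\<close>, hence
  one polynomial for all integers N. At height q only nonnegative indices survive, at height -q only
  negative ones. Negating the coefficients of the latter gives points of the complementary half-open
  simplex, evaluated at -m.\<close>

lemma half_open_simplex_reciprocity:
  fixes \<phi> :: "'a::euclidean_space \<Rightarrow> complex"
  assumes M: "discrete_subgroup M" and B: "finite B" "B \<noteq> {}" "\<not> affine_dependent B" "B \<subseteq> M"
    and \<phi>: "polyfun \<phi>"
  shows "\<exists>S. \<forall>q::nat. q > 0 \<longrightarrow>
    poly S (of_nat q) = (\<Sum>m\<in>M \<inter> (\<lambda>x. real q *\<^sub>R x) ` half_open_simplex B J. \<phi> m) \<and>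
    poly S (- of_nat q) = (-1) ^ (card B - 1) *
       (\<Sum>m\<in>M \<inter> (\<lambda>x. real q *\<^sub>R x) ` half_open_simplex B (B - J). \<phi> (- m))"
proof -
  define C where "C = cell_points M B J"
  define L where "L Q N = {\<mu>. (\<forall>b. b \<notin> B \<longrightarrow> \<mu> b = 0) \<and> lin_comb B \<mu> \<in> M \<and> sum \<mu> B = of_int N
              \<and> (\<forall>b\<in>B. Q (cell_index J b (\<mu> b)))}" for Q N
  define \<psi> where "\<psi> c k = \<phi> (lin_comb B c + (\<Sum>b\<in>B. of_int (k b) *\<^sub>R b))" for c k
  have "\<exists>T. \<forall>N. comp_sum B (\<psi> c) N = poly T (of_int N)" for c
    unfolding \<psi>_def by (intro comp_sum_poly B polyfun_prod_poly_span \<phi>)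
  then obtain T where T: "\<And>c N. comp_sum B (\<psi> c) N = poly (T c) (of_int N)" by metis
  \<comment> \<open>Each cell point already uses up its height, so the remaining parts have sum N
    minus that height. The height is an integer, and the floor merely converts its type.\<close>
  define S where "S = (\<Sum>c\<in>C. pcompose (T c) [:- of_int \<lfloor>sum c B\<rfloor>, 1:])"
  have pos: "(\<Sum>c\<in>C. \<Sum>k\<in>nonneg_comp B (N - \<lfloor>sum c B\<rfloor>). \<psi> c k) = (\<Sum>\<mu>\<in>L (\<lambda>t. 0 \<le> t) N. \<phi> (lin_comb B \<mu>))" for N
    unfolding C_def L_def \<psi>_def nonneg_comp_def
    by (rule sum_cell_decomposition[symmetric, OF M B(1,3,4)])
       (use finite_nonneg_comp[OF B(1), unfolded nonneg_comp_def] in blast)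
  have neg: "(\<Sum>c\<in>C. \<Sum>k\<in>neg_comp B (N - \<lfloor>sum c B\<rfloor>). \<psi> c k) = (\<Sum>\<mu>\<in>L (\<lambda>t. t \<le> -1) N. \<phi> (lin_comb B \<mu>))" for N
    unfolding C_def L_def \<psi>_def neg_comp_def
    by (rule sum_cell_decomposition[symmetric, OF M B(1,3,4)])
       (use finite_neg_comp[OF B(1), unfolded neg_comp_def] in blast)
  have S: "poly S (of_int N) = (\<Sum>\<mu>\<in>L (\<lambda>t. 0 \<le> t) N. \<phi> (lin_comb B \<mu>))
     + (-1) ^ (card B - 1) * (\<Sum>\<mu>\<in>L (\<lambda>t. t \<le> -1) N. \<phi> (lin_comb B \<mu>))" for N
  proof -
    have "poly S (of_int N) = (\<Sum>c\<in>C. poly (T c) (of_int (N - \<lfloor>sum c B\<rfloor>)))"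
      by (simp add: S_def poly_sum poly_pcompose)
    also have "\<dots> = (\<Sum>c\<in>C. comp_sum B (\<psi> c) (N - \<lfloor>sum c B\<rfloor>))" by (simp only: T)
    finally show ?thesis
      by (simp only: comp_sum_def sum.distrib pos neg sum_distrib_left[symmetric])
  qed
  have "poly S (of_nat q) = (\<Sum>m\<in>M \<inter> (\<lambda>x. real q *\<^sub>R x) ` half_open_simplex B J. \<phi> m) \<and>
    poly S (- of_nat q) = (-1) ^ (card B - 1) *
       (\<Sum>m\<in>M \<inter> (\<lambda>x. real q *\<^sub>R x) ` half_open_simplex B (B - J). \<phi> (- m))"
    if q: "q > 0" for q :: nat
  proof
    \<comment> \<open>Emptiness holds for the families \<mu> as a whole: negative indices mean
      nonpositive coefficients, whose sum cannot be q > 0. The argument N minus height of an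
      individual cell point may well be negative. The next claim is the mirror image at -q.\<close>
    have e1: "L (\<lambda>t. t \<le> -1) (int q) = {}"
    proof -
      have False if "\<mu> \<in> L (\<lambda>t. t \<le> -1) (int q)" for \<mu>
      proof -
        have "\<forall>b\<in>B. \<mu> b \<le> 0" "sum \<mu> B = real q"
          using that by (auto simp: L_def cell_index_neg)
        then show False using q sum_nonpos[of B \<mu>] by auto
      qed
      then show ?thesis by blast
    qed
    have e2: "L (\<lambda>t. 0 \<le> t) (- int q) = {}"
    proof -
      have False if "\<mu> \<in> L (\<lambda>t. 0 \<le> t) (- int q)" for \<mu>
      proof -
        have "\<forall>b\<in>B. 0 \<le> \<mu> b" "sum \<mu> B = - real q"
          using that by (auto simp: L_def cell_index_nonneg)
        then show False using q sum_nonneg[of B \<mu>] by auto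
      qed
      then show ?thesis by blast
    qed
    have "poly S (of_nat q) = (\<Sum>\<mu>\<in>L (\<lambda>t. 0 \<le> t) (int q). \<phi> (lin_comb B \<mu>))"
      using S[of "int q"] by (simp add: e1)
    also have "\<dots> = (\<Sum>m\<in>M \<inter> (\<lambda>x. real q *\<^sub>R x) ` half_open_simplex B J. \<phi> m)"
      unfolding L_def cell_index_nonneg using q
      by (subst sum_over_half_open_simplex[OF B(1,3)]) simp_all
    finally show "poly S (of_nat q) = (\<Sum>m\<in>M \<inter> (\<lambda>x. real q *\<^sub>R x) ` half_open_simplex B J. \<phi> m)" .
    have "poly S (- of_nat q) = (-1) ^ (card B - 1) * (\<Sum>\<mu>\<in>L (\<lambda>t. t \<le> -1) (- int q). \<phi> (lin_comb B \<mu>))"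
      using S[of "- int q"] by (simp add: e2)
    also have "(\<Sum>\<mu>\<in>L (\<lambda>t. t \<le> -1) (- int q). \<phi> (lin_comb B \<mu>)) =
        (\<Sum>\<nu>\<in>{\<nu>. (\<forall>b. b \<notin> B \<longrightarrow> \<nu> b = 0) \<and> lin_comb B \<nu> \<in> M \<and> sum \<nu> B = real q
         \<and> (\<forall>b\<in>B. 0 \<le> \<nu> b \<and> (b \<in> B - J \<longrightarrow> 0 < \<nu> b))}. \<phi> (- lin_comb B \<nu>))"
    proof (rule sum.reindex_bij_witness[where i = "\<lambda>\<nu> b. - \<nu> b" and j = "\<lambda>\<mu> b. - \<mu> b"])
      fix \<mu> assume "\<mu> \<in> L (\<lambda>t. t \<le> -1) (- int q)"
      moreover from this have "- lin_comb B \<mu> \<in> M"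
        using M by (auto simp: L_def discrete_subgroup_def)
      ultimately show "(\<lambda>b. - \<mu> b) \<in> {\<nu>. (\<forall>b. b \<notin> B \<longrightarrow> \<nu> b = 0) \<and> lin_comb B \<nu> \<in> M \<and> sum \<nu> B = real q
         \<and> (\<forall>b\<in>B. 0 \<le> \<nu> b \<and> (b \<in> B - J \<longrightarrow> 0 < \<nu> b))}"
        unfolding L_def cell_index_neg by (auto simp: lin_comb_uminus sum_negf)
    next
      fix \<nu> assume \<nu>: "\<nu> \<in> {\<nu>. (\<forall>b. b \<notin> B \<longrightarrow> \<nu> b = 0) \<and> lin_comb B \<nu> \<in> M \<and> sum \<nu> B = real q
         \<and> (\<forall>b\<in>B. 0 \<le> \<nu> b \<and> (b \<in> B - J \<longrightarrow> 0 < \<nu> b))}"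
      moreover from this have "- lin_comb B \<nu> \<in> M"
        using M by (auto simp: discrete_subgroup_def)
      ultimately show "(\<lambda>b. - \<nu> b) \<in> L (\<lambda>t. t \<le> -1) (- int q)"
        unfolding L_def cell_index_neg by (auto simp: lin_comb_uminus sum_negf)
    qed (auto simp: lin_comb_uminus)
    also have "\<dots> = (\<Sum>m\<in>M \<inter> (\<lambda>x. real q *\<^sub>R x) ` half_open_simplex B (B - J). \<phi> (- m))"
      using q by (subst sum_over_half_open_simplex[OF B(1,3)]) simp_all
    finally show "poly S (- of_nat q) = (-1) ^ (card B - 1) *
       (\<Sum>m\<in>M \<inter> (\<lambda>x. real q *\<^sub>R x) ` half_open_simplex B (B - J). \<phi> (- m))" .
  qed
  then show ?thesis by blast
qed

section \<open>Pulling triangulations\<close>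

text \<open>A point off the relative interior lies in some facet, which is a polytope of smaller
  dimension, and faces of a facet are faces of \<open>P\<close>.\<close>

lemma polytope_point_in_face_interior:
  fixes P :: "'a::euclidean_space set"
  assumes "polytope P" "x \<in> P"
  obtains F where "F face_of P" "x \<in> rel_interior F"
proof -
  have "\<exists>F. F face_of P \<and> x \<in> rel_interior F"
    using assms
  proof (induction "nat (aff_dim P)" arbitrary: P rule: less_induct)
    case less
    show ?case
    proof (cases "x \<in> rel_interior P")
      case True
      then show ?thesis using less.prems face_of_refl polytope_imp_convex by blast
    next
      case False
      then obtain G where G: "G facet_of P" "x \<in> G"
        using less.prems rel_boundary_of_polyhedron[OF polytope_imp_polyhedron] by blast
      then have Gf: "G face_of P" by (simp add: facet_of_imp_face_of)
      have "aff_dim G = aff_dim P - 1" using G by (simp add: facet_of_def)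
      moreover have "aff_dim G \<ge> 0" using G(2) by (metis aff_dim_negative_iff empty_iff not_le)
      ultimately have "nat (aff_dim G) < nat (aff_dim P)" by simp
      then obtain F where "F face_of G" "x \<in> rel_interior F"
        using less.hyps[of G] G Gf less.prems face_of_polytope_polytope by blast
      then show ?thesis using Gf face_of_trans by blast
    qed
  qed
  with that show thesis by blast
qed

lemma rel_interior_simplex:
  fixes B :: "'a::euclidean_space set"
  assumes "\<not> affine_dependent B"
  shows "rel_interior (convex hull B) = {lin_comb B u | u. (\<forall>b\<in>B. 0 < u b) \<and> sum u B = 1}"
  unfolding rel_interior_convex_hull_explicit[OF assms] lin_comb_def by fastforce

text \<open>Here \<open>t\<close> is the total barycentric weight on \<open>B\<close>; dividing
  those weights by \<open>t\<close> gives the base point \<open>y\<close>.\<close>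

lemma rel_interior_cone_simplex:
  fixes B :: "'a::euclidean_space set"
  assumes "\<not> affine_dependent (insert v B)" "v \<notin> B" "B \<noteq> {}"
  shows "x \<in> rel_interior (convex hull (insert v B)) \<longleftrightarrow>
    (\<exists>y\<in>rel_interior (convex hull B). \<exists>t. 0 < t \<and> t < 1 \<and> x = (1 - t) *\<^sub>R v + t *\<^sub>R y)"
proof -
  have ai: "\<not> affine_dependent B" using assms(1) affine_dependent_subset by blast
  have fin: "finite B" using ai aff_independent_finite by blast
  show ?thesis
  proof
    assume "x \<in> rel_interior (convex hull (insert v B))"
    then obtain u where u: "x = lin_comb (insert v B) u" "\<forall>b\<in>insert v B. 0 < u b" "sum u (insert v B) = 1"
      unfolding rel_interior_simplex[OF assms(1)] by blast
    define t where "t = sum u B"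
    have t: "0 < t" "u v = 1 - t"
      using u fin assms by (auto simp: t_def intro: sum_pos)
    then have t1: "t < 1" using u by auto
    have "sum (\<lambda>b. 1/t * u b) B = 1"
      using t unfolding sum_distrib_left[symmetric] by (simp flip: t_def)
    then have "lin_comb B (\<lambda>b. 1/t * u b) \<in> rel_interior (convex hull B)"
      unfolding rel_interior_simplex[OF ai] using u t
      by (intro CollectI exI[of _ "\<lambda>b. 1/t * u b"]) auto
    moreover have "x = (1 - t) *\<^sub>R v + t *\<^sub>R lin_comb B (\<lambda>b. 1/t * u b)"
      unfolding u(1) lin_comb_scale using fin assms t by (simp add: lin_comb_def)
    ultimately show "\<exists>y\<in>rel_interior (convex hull B). \<exists>t. 0 < t \<and> t < 1 \<and> x = (1 - t) *\<^sub>R v + t *\<^sub>R y"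
      using t t1 by blast
  next
    assume "\<exists>y\<in>rel_interior (convex hull B). \<exists>t. 0 < t \<and> t < 1 \<and> x = (1 - t) *\<^sub>R v + t *\<^sub>R y"
    then obtain u t where u: "\<forall>b\<in>B. 0 < u b" "sum u B = 1" "0 < t" "t < 1"
      and x: "x = (1 - t) *\<^sub>R v + t *\<^sub>R lin_comb B u"
      unfolding rel_interior_simplex[OF ai] by blast
    define w where "w = (\<lambda>b. if b = v then 1 - t else t * u b)"
    have "lin_comb B w = t *\<^sub>R lin_comb B u"
      unfolding lin_comb_scale[symmetric] using assms by (intro lin_comb_cong) (auto simp: w_def)
    moreover have "sum w B = t * sum u B"
      unfolding sum_distrib_left using assms by (intro sum.cong) (auto simp: w_def)
    ultimately have "x = lin_comb (insert v B) w" "sum w (insert v B) = 1"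
      using x u fin assms by (simp_all add: lin_comb_def w_def)
    moreover have "\<forall>b\<in>insert v B. 0 < w b" using u by (auto simp: w_def)
    ultimately show "x \<in> rel_interior (convex hull (insert v B))"
      unfolding rel_interior_simplex[OF assms(1)] by blast
  qed
qed

text \<open>The simplices are cones from a fixed vertex over simplices of the faces not containing it.\<close>

lemma pulling_triangulation:
  fixes P :: "'a::euclidean_space set"
  assumes "polytope P" "P \<noteq> {}"
  shows "\<exists>T. finite T \<and>
    (\<forall>B\<in>T. B \<noteq> {} \<and> \<not> affine_dependent B \<and> B \<subseteq> {x. x extreme_point_of P}
        \<and> rel_interior (convex hull B) \<subseteq> rel_interior P) \<and>
    (\<forall>x\<in>rel_interior P. \<exists>!B. B \<in> T \<and> x \<in> rel_interior (convex hull B))"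
  using assms
proof (induction "nat (aff_dim P)" arbitrary: P rule: less_induct)
  case less
  note P = less.prems
  have cP: "convex P" "compact P" "closed P"
    using P(1) by (simp_all add: polytope_imp_convex polytope_imp_compact polytope_imp_closed)
  obtain v where v: "v extreme_point_of P"
    using extreme_point_exists_convex[OF cP(2,1) P(2)] .
  then have vP: "v \<in> P" by (simp add: extreme_point_of_def)
  show ?case
  proof (cases "P = {v}")
    case True
    have r: "rel_interior {v} = {v}" by simp
    show ?thesis
      unfolding True by (intro exI[of _ "{{v}}"]) (simp add: r cong: conj_cong)
  next
    case False
    then have v_ni: "v \<notin> rel_interior P" using extreme_point_not_in_REL_INTERIOR[OF v] by simp
    define \<F> where "\<F> = {F. F face_of P \<and> F \<noteq> {} \<and> v \<notin> F}"
    have fin: "finite \<F>"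
      using finite_polytope_faces[OF P(1)] unfolding \<F>_def by (rule rev_finite_subset) blast
    define good where "good F T \<longleftrightarrow> finite T \<and>
       (\<forall>B\<in>T. B \<noteq> {} \<and> \<not> affine_dependent B \<and> B \<subseteq> {x. x extreme_point_of F}
          \<and> rel_interior (convex hull B) \<subseteq> rel_interior F) \<and>
       (\<forall>x\<in>rel_interior F. \<exists>!B. B \<in> T \<and> x \<in> rel_interior (convex hull B))"
      for F :: "'a set" and T
    have "\<exists>T. good F T" if "F \<in> \<F>" for F
      unfolding good_def
    proof (rule less.hyps)
      have F: "F face_of P" "F \<noteq> {}" "F \<noteq> P" using that vP by (auto simp: \<F>_def)
      then have "aff_dim F < aff_dim P" using face_of_aff_dim_lt[OF cP(1)] by simp
      moreover have "aff_dim F \<ge> 0" using F(2) by (metis aff_dim_negative_iff not_le)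
      ultimately show "nat (aff_dim F) < nat (aff_dim P)" by simp
      show "polytope F" "F \<noteq> {}" using F P(1) face_of_polytope_polytope by auto
    qed
    then obtain \<T> where "\<forall>F\<in>\<F>. good F (\<T> F)"
      using bchoice[of \<F> good] by auto
    then have good: "good F (\<T> F)" if "F \<in> \<F>" for F
      using that by simp
    have T1: "finite (\<T> F)" if "F \<in> \<F>" for F
      using good[OF that] unfolding good_def by (elim conjE)
    have T2: "B \<noteq> {}" "\<not> affine_dependent B" "B \<subseteq> {x. x extreme_point_of F}"
      "rel_interior (convex hull B) \<subseteq> rel_interior F" if "F \<in> \<F>" "B \<in> \<T> F" for F B
    proof -
      have "\<forall>B\<in>\<T> F. B \<noteq> {} \<and> \<not> affine_dependent B \<and> B \<subseteq> {x. x extreme_point_of F}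
          \<and> rel_interior (convex hull B) \<subseteq> rel_interior F"
        using good[OF that(1)] unfolding good_def by (elim conjE)
      from bspec[OF this that(2)]
      show "B \<noteq> {}" "\<not> affine_dependent B" "B \<subseteq> {x. x extreme_point_of F}"
        "rel_interior (convex hull B) \<subseteq> rel_interior F" by simp_all
    qed
    have T3: "\<exists>!B. B \<in> \<T> F \<and> x \<in> rel_interior (convex hull B)"
      if "F \<in> \<F>" "x \<in> rel_interior F" for F x
      using good[OF that(1)] that(2) unfolding good_def by (elim conjE) (rule bspec)
    have cone: "\<not> affine_dependent (insert v B)" "v \<notin> B" "B \<noteq> {}"
        "insert v B \<subseteq> {x. x extreme_point_of P}"
      if "F \<in> \<F>" "B \<in> \<T> F" for F B
    proof -
      have F: "F face_of P" "v \<notin> F" using that by (auto simp: \<F>_def)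
      have B: "B \<noteq> {}" "\<not> affine_dependent B" "B \<subseteq> {x. x extreme_point_of F}"
        using T2[OF that] by auto
      have BF: "B \<subseteq> F" using B(3) by (auto simp: extreme_point_of_def)
      have "v \<notin> affine hull F"
        using face_of_imp_eq_affine_Int[OF cP(1) F(1)] F(2) vP by auto
      then have "v \<notin> affine hull B" using hull_mono[OF BF, of affine] by auto
      then show "\<not> affine_dependent (insert v B)" using affine_independent_insert[OF B(2)] by simp
      show "v \<notin> B" "B \<noteq> {}" using BF F B by auto
      show "insert v B \<subseteq> {x. x extreme_point_of P}"
        using B(3) v extreme_point_of_face[OF F(1)] by auto
    qed
    \<comment> \<open>If \<open>v\<close> and \<open>F\<close> lie in a common proper face of
      \<open>P\<close>, the cone over \<open>F\<close> stays in the boundary. The inclusion of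
      relative interiors discards these cones.\<close>
    define T where "T = {insert v B | F B. F \<in> \<F> \<and> B \<in> \<T> F \<and>
        rel_interior (convex hull (insert v B)) \<subseteq> rel_interior P}"
    have "finite T"
    proof (rule finite_subset)
      show "T \<subseteq> insert v ` (\<Union>F\<in>\<F>. \<T> F)" by (auto simp: T_def)
      show "finite (insert v ` (\<Union>F\<in>\<F>. \<T> F))" using fin T1 by (intro finite_imageI finite_UN_I)
    qed
    moreover have "\<forall>B\<in>T. B \<noteq> {} \<and> \<not> affine_dependent B \<and> B \<subseteq> {x. x extreme_point_of P}
        \<and> rel_interior (convex hull B) \<subseteq> rel_interior P"
    proof
      fix B assume "B \<in> T"
      then obtain F B' where "B = insert v B'" "F \<in> \<F>" "B' \<in> \<T> F"
        "rel_interior (convex hull B) \<subseteq> rel_interior P" unfolding T_def by blast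
      then show "B \<noteq> {} \<and> \<not> affine_dependent B \<and> B \<subseteq> {x. x extreme_point_of P}
        \<and> rel_interior (convex hull B) \<subseteq> rel_interior P"
        using cone[of F B'] by simp
    qed
    moreover have "\<exists>!B. B \<in> T \<and> x \<in> rel_interior (convex hull B)" if x: "x \<in> rel_interior P" for x
    proof (rule ex_ex1I)
      have xP: "x \<in> P" using x rel_interior_subset by blast
      have xv: "x \<noteq> v" using x v_ni by blast
      \<comment> \<open>The ray from \<open>v\<close> through \<open>x\<close> is prolonged until it
        leaves \<open>P\<close> at a boundary point \<open>y\<close>; the face with \<open>y\<close>
        in its relative interior supplies the base of the cone containing \<open>x\<close>.\<close>
      have aff: "x + (x - v) \<in> affine hull P"
        using mem_affine[OF affine_affine_hull hull_inc[OF xP] hull_inc[OF vP], of 2 "-1"]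
        by (simp add: scaleR_2 algebra_simps)
      obtain d where d: "0 < d" "x + d *\<^sub>R (x - v) \<in> rel_frontier P"
        using ray_to_rel_frontier[OF compact_imp_bounded[OF cP(2)] x aff] xv by (metis eq_iff_diff_eq_0)
      define y where "y = x + d *\<^sub>R (x - v)"
      have y: "y \<in> P" "y \<notin> rel_interior P"
        using d cP by (auto simp: y_def rel_frontier_def)
      obtain F where F: "F face_of P" "y \<in> rel_interior F"
        using polytope_point_in_face_interior[OF P(1) y(1)] .
      define t where "t = 1 / (1 + d)"
      have t: "0 < t" "t < 1" using d by (auto simp: t_def)
      have "(1 + d) *\<^sub>R x = d *\<^sub>R v + y" by (simp add: y_def algebra_simps)
      then have "t *\<^sub>R (1 + d) *\<^sub>R x = t *\<^sub>R (d *\<^sub>R v + y)" by simp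
      moreover have "t * (1 + d) = 1" "t * d = 1 - t" using d by (auto simp: t_def field_simps)
      ultimately have xt: "x = (1 - t) *\<^sub>R v + t *\<^sub>R y" by (simp add: scaleR_add_right)
      \<comment> \<open>Otherwise the segment from \<open>v\<close> to \<open>y\<close>, and with it
        the interior point \<open>x\<close>, would lie in \<open>F\<close>. This forces
        \<open>F = P\<close> and makes \<open>y\<close> interior.\<close>
      have "v \<notin> F"
      proof
        assume "v \<in> F"
        moreover have "y \<in> F" using F rel_interior_subset by blast
        ultimately have "x \<in> F"
          unfolding xt using t face_of_imp_convex[OF F(1)] by (intro convexD) auto
        then have "F = P" using face_of_disjoint_rel_interior[OF F(1)] x by blast
        with F y show False by blast
      qed
      then have F\<F>: "F \<in> \<F>" using F by (auto simp: \<F>_def)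
      then obtain B where B: "B \<in> \<T> F" "y \<in> rel_interior (convex hull B)"
        using T3[OF F\<F> F(2)] by (elim ex1E conjE)
      have xin: "x \<in> rel_interior (convex hull (insert v B))"
        using rel_interior_cone_simplex[OF cone(1-3)[OF F\<F> B(1)]] B xt t by blast
      have sub: "convex hull (insert v B) \<subseteq> P"
        using cone(4)[OF F\<F> B(1)] cP by (intro hull_minimal) (auto simp: extreme_point_of_def)
      have "rel_interior (convex hull (insert v B)) \<subseteq> rel_interior P"
      proof (rule subset_rel_interior_convex)
        show "\<not> convex hull (insert v B) \<subseteq> rel_frontier P"
          using xin x rel_interior_subset unfolding rel_frontier_def by blast
      qed (use cP sub closure_subset in auto)
      then show "\<exists>B. B \<in> T \<and> x \<in> rel_interior (convex hull B)"
        using F\<F> B xin unfolding T_def by blast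
    next
      fix B1 B2
      assume "B1 \<in> T \<and> x \<in> rel_interior (convex hull B1)" "B2 \<in> T \<and> x \<in> rel_interior (convex hull B2)"
      then obtain F1 C1 F2 C2 where C: "F1 \<in> \<F>" "C1 \<in> \<T> F1" "B1 = insert v C1"
          "F2 \<in> \<F>" "C2 \<in> \<T> F2" "B2 = insert v C2"
        and xB: "x \<in> rel_interior (convex hull (insert v C1))" "x \<in> rel_interior (convex hull (insert v C2))"
        unfolding T_def by blast
      obtain y1 t1 where y1: "y1 \<in> rel_interior (convex hull C1)" "0 < t1" "t1 < 1" "x = (1 - t1) *\<^sub>R v + t1 *\<^sub>R y1"
        using xB(1) rel_interior_cone_simplex[OF cone(1-3)[OF C(1,2)]] by blast
      obtain y2 t2 where y2: "y2 \<in> rel_interior (convex hull C2)" "0 < t2" "t2 < 1" "x = (1 - t2) *\<^sub>R v + t2 *\<^sub>R y2"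
        using xB(2) rel_interior_cone_simplex[OF cone(1-3)[OF C(4,5)]] by blast
      have yF: "y1 \<in> rel_interior F1" "y2 \<in> rel_interior F2"
        using y1(1) y2(1) T2(4)[OF C(1,2)] T2(4)[OF C(4,5)] by (auto dest: subsetD)
      \<comment> \<open>Both base points lie on the ray from \<open>v\<close> through
        \<open>x\<close>. If \<open>y\<close> were strictly nearer to \<open>v\<close> than
        \<open>y'\<close>, it would be inside the segment from \<open>v\<close> to
        \<open>y'\<close>, and the face property of \<open>F\<close> at \<open>y\<close> would put
        \<open>v\<close> into \<open>F\<close>.\<close>
      have order: "\<not> s < t"
        if F: "F \<in> \<F>" "F' \<in> \<F>" and y: "y \<in> rel_interior F" "y' \<in> rel_interior F'"
          and s: "0 < s" and e: "(1 - s) *\<^sub>R v + s *\<^sub>R y' = (1 - t) *\<^sub>R v + t *\<^sub>R y"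
        for s t y y' F F'
      proof
        assume st: "s < t"
        have t: "0 < t" using s st by simp
        have "y \<noteq> v" using y(1) F(1) rel_interior_subset[of F] by (auto simp: \<F>_def)
        have "t *\<^sub>R (y - v) = s *\<^sub>R (y' - v)" using e by (simp add: algebra_simps)
        then have "(1/t) *\<^sub>R t *\<^sub>R (y - v) = (1/t) *\<^sub>R s *\<^sub>R (y' - v)" by simp
        then have eq: "y - v = (s/t) *\<^sub>R (y' - v)" using t by simp
        then have "y = (1 - s/t) *\<^sub>R v + (s/t) *\<^sub>R y'" by (simp add: algebra_simps)
        moreover have "0 < s/t" "s/t < 1" using s st by auto
        moreover have "v \<noteq> y'" using eq \<open>y \<noteq> v\<close> by auto
        ultimately have "y \<in> open_segment v y'" unfolding in_segment by blast
        moreover have F': "F face_of P" "F' face_of P" "v \<notin> F" using F by (auto simp: \<F>_def)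
        moreover have "y \<in> F" using y(1) rel_interior_subset[of F] by auto
        moreover have "y' \<in> P"
          using y(2) rel_interior_subset[of F'] face_of_imp_subset[OF F'(2)] by auto
        ultimately show False using vP face_ofD[of F P y v y'] by simp
      qed
      have e: "(1 - t2) *\<^sub>R v + t2 *\<^sub>R y2 = (1 - t1) *\<^sub>R v + t1 *\<^sub>R y1"
        using y2(4) y1(4) by (rule trans[OF sym])
      have "\<not> t2 < t1" by (rule order[OF C(1,4) yF y2(2) e])
      moreover have "\<not> t1 < t2" by (rule order[OF C(4,1) yF(2,1) y1(2) e[symmetric]])
      ultimately have "t1 = t2" by simp
      then have "y1 = y2" using e y1(2) by simp
      then have "F1 = F2" using yF C(1,4) face_of_eq[of F1 P F2] by (auto simp: \<F>_def)
      have "\<exists>!B. B \<in> \<T> F1 \<and> y1 \<in> rel_interior (convex hull B)" by (rule T3[OF C(1) yF(1)])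
      moreover have "C1 \<in> \<T> F1 \<and> y1 \<in> rel_interior (convex hull C1)" using C y1(1) by simp
      moreover have "C2 \<in> \<T> F1 \<and> y1 \<in> rel_interior (convex hull C2)"
        using C y2(1) \<open>F1 = F2\<close> \<open>y1 = y2\<close> by simp
      ultimately have "C1 = C2" by blast
      then show "B1 = B2" using C(3,6) by simp
    qed
    ultimately show ?thesis by (intro exI[of _ T]) simp
  qed
qed

section \<open>Half-open decompositions\<close>

lemma affine_line:
  assumes "affine A" "(1 - s) *\<^sub>R a + s *\<^sub>R b \<in> A" "(1 - t) *\<^sub>R a + t *\<^sub>R b \<in> A" "s \<noteq> (t::real)"
  shows "(1 - r) *\<^sub>R a + r *\<^sub>R b \<in> A"
proof -
  define u where "u = (r - s) / (t - s)"
  have u: "u * (t - s) = r - s" using assms(4) by (simp add: u_def)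
  have "(1 - u) *\<^sub>R ((1 - s) *\<^sub>R a + s *\<^sub>R b) + u *\<^sub>R ((1 - t) *\<^sub>R a + t *\<^sub>R b) \<in> A"
    by (rule mem_affine[OF assms(1-3)]) simp
  also have "(1 - u) *\<^sub>R ((1 - s) *\<^sub>R a + s *\<^sub>R b) + u *\<^sub>R ((1 - t) *\<^sub>R a + t *\<^sub>R b)
      = (1 - (s + u * (t - s))) *\<^sub>R a + (s + u * (t - s)) *\<^sub>R b"
    by (simp add: algebra_simps)
  finally show ?thesis unfolding u by simp
qed

text \<open>Join a point avoiding the earlier sets to a point avoiding the new one. Each affine set
  meets the line in at most one parameter, because two would put both end points into it; so all but
  finitely many parameters in [0,1] are good.\<close>

lemma convex_not_covered_by_affine:
  fixes C :: "'a::real_vector set"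
  assumes "finite \<A>" "convex C" "C \<noteq> {}" "\<And>A. A \<in> \<A> \<Longrightarrow> affine A \<and> \<not> C \<subseteq> A"
  shows "\<exists>x\<in>C. \<forall>A\<in>\<A>. x \<notin> A"
  using assms(1,4)
proof (induction \<A> rule: finite_induct)
  case empty
  then show ?case using assms(3) by blast
next
  case (insert A \<A>)
  obtain a where a: "a \<in> C" "\<forall>A\<in>\<A>. a \<notin> A" using insert.IH insert.prems by auto
  obtain b where b: "b \<in> C" "b \<notin> A" using insert.prems[of A] by auto
  let ?p = "\<lambda>t. (1 - t) *\<^sub>R a + t *\<^sub>R b"
  have sub: "\<exists>s. {t. ?p t \<in> A'} \<subseteq> {s}" if "A' \<in> insert A \<A>" for A'
  proof (rule ccontr)
    assume contr: "\<nexists>s. {t. ?p t \<in> A'} \<subseteq> {s}"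
    then have ne: "\<not> {t. ?p t \<in> A'} \<subseteq> {s}" for s by simp
    obtain s where s: "?p s \<in> A'" using ne[of 0] by auto
    obtain t where "t \<noteq> s" "?p t \<in> A'" using ne[of s] by blast
    with s have "s \<noteq> t" "?p s \<in> A'" "?p t \<in> A'" by simp_all
    then have "?p r \<in> A'" for r
      using affine_line[of A' s a b t r] insert.prems[OF that] by simp
    from this[of 0] this[of 1] have "a \<in> A'" "b \<in> A'" by simp_all
    then show False using a b that by auto
  qed
  have "finite {t. ?p t \<in> A'}" if "A' \<in> insert A \<A>" for A'
    using sub[OF that] finite_subset by auto
  then have fin: "finite (\<Union>A'\<in>insert A \<A>. {t. ?p t \<in> A'})"
    using insert.hyps(1) by (intro finite_UN_I) auto
  have "\<not> {0..1::real} \<subseteq> (\<Union>A'\<in>insert A \<A>. {t. ?p t \<in> A'})"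
  proof
    assume "{0..1::real} \<subseteq> (\<Union>A'\<in>insert A \<A>. {t. ?p t \<in> A'})"
    then have "finite {0..1::real}" using fin by (rule finite_subset)
    then show False using infinite_Icc[of 0 "1::real"] by simp
  qed
  then obtain t where "t \<in> {0..1}" and t: "\<forall>A'\<in>insert A \<A>. ?p t \<notin> A'" by blast
  then have "0 \<le> t" "t \<le> 1" by simp_all
  then have "?p t \<in> C" using assms(2) a(1) b(1) by (intro convexD) auto
  with t show ?case by blast
qed

lemma half_open_simplex_subset: "finite B \<Longrightarrow> half_open_simplex B J \<subseteq> convex hull B"
  unfolding half_open_simplex_def lin_comb_def by (auto simp: convex_hull_finite)

lemma lin_comb_affine:
  "lin_comb B u + t *\<^sub>R (lin_comb B v - lin_comb B u) = lin_comb B (\<lambda>b. (1 - t) * u b + t * v b)"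
  unfolding lin_comb_add lin_comb_scale by (simp add: algebra_simps)

text \<open>A generic point w decides, for each maximal simplex, which facets are kept: moving from x
  slightly towards w enters the interior of exactly one maximal simplex, and x is assigned to
  it. Moving away from w instead gives the complementary choice of facets.\<close>

lemma half_open_decomposition:
  fixes P :: "'a::euclidean_space set"
  assumes "polytope P" "P \<noteq> {}"
  shows "\<exists>T J. finite T \<and>
    (\<forall>B\<in>T. B \<noteq> {} \<and> \<not> affine_dependent B \<and> B \<subseteq> {x. x extreme_point_of P} \<and> int (card B) = aff_dim P + 1) \<and>
    P = (\<Union>B\<in>T. half_open_simplex B (J B)) \<and>
    disjoint_family_on (\<lambda>B. half_open_simplex B (J B)) T \<and>
    rel_interior P = (\<Union>B\<in>T. half_open_simplex B (B - J B)) \<and>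
    disjoint_family_on (\<lambda>B. half_open_simplex B (B - J B)) T"
proof -
  have cP: "convex P" "closed P" using assms(1) by (simp_all add: polytope_imp_convex polytope_imp_closed)
  obtain T0 where T0: "finite T0"
    "\<forall>B\<in>T0. B \<noteq> {} \<and> \<not> affine_dependent B \<and> B \<subseteq> {x. x extreme_point_of P}
        \<and> rel_interior (convex hull B) \<subseteq> rel_interior P"
    "\<forall>x\<in>rel_interior P. \<exists>!B. B \<in> T0 \<and> x \<in> rel_interior (convex hull B)"
    using pulling_triangulation[OF assms] by (elim exE conjE)
  have B0: "B \<noteq> {}" "\<not> affine_dependent B" "finite B" "B \<subseteq> {x. x extreme_point_of P}" "B \<subseteq> P"
     "rel_interior (convex hull B) \<subseteq> rel_interior P" if "B \<in> T0" for B
  proof -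
    from bspec[OF T0(2) that] show ai: "\<not> affine_dependent B" and "B \<noteq> {}"
      and ex: "B \<subseteq> {x. x extreme_point_of P}"
      and "rel_interior (convex hull B) \<subseteq> rel_interior P" by simp_all
    show "finite B" using ai aff_independent_finite by auto
    show "B \<subseteq> P" using ex by (auto simp: extreme_point_of_def)
  qed
  \<comment> \<open>Avoiding the spans of all lower-dimensional vertex subsets has two effects: the
    coordinates of \<open>w\<close> in a maximal simplex are all nonzero, and \<open>w\<close> is in
    the span of no lower-dimensional simplex of \<open>T0\<close>.\<close>
  define \<A> where "\<A> = (hull) affine ` {B'. B' \<in> \<Union> (Pow ` T0) \<and> aff_dim B' < aff_dim P}"
  have "\<exists>w\<in>rel_interior P. \<forall>A\<in>\<A>. w \<notin> A"
  proof (rule convex_not_covered_by_affine)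
    have "finite (\<Union> (Pow ` T0))" using T0(1) B0(3) by (intro finite_UN_I) auto
    then show "finite \<A>" unfolding \<A>_def by (rule finite_imageI[OF finite_subset[OF Collect_restrict]])
    show "convex (rel_interior P)" using cP by (simp add: convex_rel_interior)
    show "rel_interior P \<noteq> {}" using cP assms(2) by (simp add: rel_interior_eq_empty)
    fix A assume "A \<in> \<A>"
    then obtain B' where B': "A = affine hull B'" "aff_dim B' < aff_dim P" by (auto simp: \<A>_def)
    have "\<not> rel_interior P \<subseteq> A"
    proof
      assume "rel_interior P \<subseteq> A"
      then have "aff_dim (rel_interior P) \<le> aff_dim A" by (rule aff_dim_subset)
      then show False using B' cP by (simp add: rel_interior_aff_dim)
    qed
    then show "affine A \<and> \<not> rel_interior P \<subseteq> A" using B' by simp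
  qed
  then obtain w where w: "w \<in> rel_interior P" "\<forall>A\<in>\<A>. w \<notin> A" by blast
  have generic: "aff_dim P \<le> aff_dim B'" if "B \<in> T0" "B' \<subseteq> B" "w \<in> affine hull B'" for B B'
  proof (rule ccontr)
    assume "\<not> aff_dim P \<le> aff_dim B'"
    then have "affine hull B' \<in> \<A>" using that unfolding \<A>_def by (intro imageI) auto
    then show False using w(2) that(3) by simp
  qed
  have wP: "w \<in> P" using w(1) rel_interior_subset[of P] by auto
  define T where "T = {B \<in> T0. aff_dim B = aff_dim P}"
  have TT0: "B \<in> T0" if "B \<in> T" for B using that by (simp add: T_def)
  have finT: "finite T" using T0(1) by (simp add: T_def)
  have "\<exists>\<beta>. sum \<beta> B = 1 \<and> lin_comb B \<beta> = w" if "B \<in> T" for B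
  proof -
    have B: "B \<in> T0" "aff_dim B = aff_dim P" using that by (auto simp: T_def)
    then have "affine hull B = affine hull P" using aff_dim_eq_full_gen[OF B0(5)[OF B(1)]] by simp
    then have "w \<in> affine hull B" using hull_inc[OF wP] by simp
    then show ?thesis unfolding affine_hull_finite[OF B0(3)[OF B(1)]] lin_comb_def by simp
  qed
  then obtain \<beta> where \<beta>: "\<And>B. B \<in> T \<Longrightarrow> sum (\<beta> B) B = 1 \<and> lin_comb B (\<beta> B) = w" by metis
  \<comment> \<open>A vanishing coordinate would place \<open>w\<close> in the span of a facet of
    the simplex, whose dimension is one too small.\<close>
  have \<beta>0: "\<beta> B b \<noteq> 0" if B: "B \<in> T" "b \<in> B" for B b
  proof
    assume z: "\<beta> B b = 0"
    note B' = TT0[OF B(1)]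
    have "sum (\<beta> B) (B - {b}) = 1" "lin_comb (B - {b}) (\<beta> B) = w"
      using \<beta>[OF B(1)] z B(2) B0(3)[OF B'] by (simp_all add: lin_comb_def sum_diff1)
    then have "w \<in> affine hull (B - {b})"
      using B0(3)[OF B'] by (auto simp: affine_hull_finite lin_comb_def)
    then have "aff_dim P \<le> aff_dim (B - {b})" using generic[OF B', of "B - {b}"] by auto
    moreover have "aff_dim (B - {b}) \<le> int (card (B - {b})) - 1"
      using B0(3)[OF B'] by (intro aff_dim_le_card) auto
    moreover have "int (card B) = aff_dim P + 1"
      using aff_dim_affine_independent[OF B0(2)[OF B']] B(1) by (simp add: T_def)
    moreover have "card B > 0" using B(2) B0(3)[OF B'] by (auto simp: card_gt_0_iff)
    ultimately show False using B(2) B0(3)[OF B'] by (simp add: of_nat_diff)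
  qed
  \<comment> \<open>The case s = 1 moves towards \<open>w\<close>, s = -1 away from it. On the facet
    opposite \<open>b\<close> the coordinate of \<open>b\<close> is 0 and changes at rate
    \<open>s * \<beta> B b\<close>; if that is negative, the motion leaves the simplex and the facet
    is removed.\<close>
  define K where "K s B = {b\<in>B. s * \<beta> B b < 0}" for s :: real and B
  define z where "z x s \<epsilon> = x + (s * \<epsilon>) *\<^sub>R (w - x)" for x s \<epsilon>
  \<comment> \<open>Positive coordinates of \<open>x\<close> stay positive for small steps by
    continuity. A zero coordinate belongs to a kept facet, so its rate of change is
    positive.\<close>
  have enters: "eventually (\<lambda>\<epsilon>. z x s \<epsilon> \<in> rel_interior (convex hull B)) (at_right 0)"
    if B: "B \<in> T" and x: "x \<in> half_open_simplex B (K s B)" and s: "s \<noteq> 0" for x s B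
  proof -
    obtain u where u: "x = lin_comb B u" "sum u B = 1" "\<And>b. b \<in> B \<Longrightarrow> 0 \<le> u b"
      "\<And>b. b \<in> B \<Longrightarrow> b \<in> K s B \<Longrightarrow> 0 < u b" using x by (auto simp: half_open_simplex_def)
    have "eventually (\<lambda>\<epsilon>. 0 < (1 - s * \<epsilon>) * u b + (s * \<epsilon>) * \<beta> B b) (at_right 0)" if b: "b \<in> B" for b
    proof (cases "u b = 0")
      case True
      then have "\<not> s * \<beta> B b < 0" using u(4)[OF b] b by (auto simp: K_def)
      moreover have "s * \<beta> B b \<noteq> 0" using \<beta>0[OF B b] s by simp
      ultimately have "s * \<beta> B b > 0" by linarith
      then have "0 < (s * \<epsilon>) * \<beta> B b" if "\<epsilon> > 0" for \<epsilon> using that by (simp add: mult.assoc mult.left_commute)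
      then show ?thesis unfolding True by (intro eventually_at_right_less[THEN eventually_mono]) simp
    next
      case False
      then have "0 < u b" using u(3)[OF b] by simp
      moreover have "((\<lambda>\<epsilon>. (1 - s * \<epsilon>) * u b + (s * \<epsilon>) * \<beta> B b) \<longlongrightarrow> (1 - s * 0) * u b + (s * 0) * \<beta> B b) (at_right 0)"
        by (intro tendsto_intros)
      ultimately show ?thesis using order_tendstoD(1) by force
    qed
    then have "eventually (\<lambda>\<epsilon>. \<forall>b\<in>B. 0 < (1 - s * \<epsilon>) * u b + (s * \<epsilon>) * \<beta> B b) (at_right 0)"
      using B0(3)[OF TT0[OF B]] by (intro eventually_ball_finite) auto
    then show ?thesis
    proof (rule eventually_mono)
      fix \<epsilon> assume pos: "\<forall>b\<in>B. 0 < (1 - s * \<epsilon>) * u b + (s * \<epsilon>) * \<beta> B b"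
      have "z x s \<epsilon> = lin_comb B (\<lambda>b. (1 - s * \<epsilon>) * u b + (s * \<epsilon>) * \<beta> B b)"
        using \<beta>[OF B] lin_comb_affine[of B u "s * \<epsilon>" "\<beta> B"] by (simp add: z_def u(1))
      moreover have "(\<Sum>b\<in>B. (1 - s * \<epsilon>) * u b + (s * \<epsilon>) * \<beta> B b) = 1"
        using \<beta>[OF B] u(2) by (simp add: sum.distrib flip: sum_distrib_left)
      ultimately show "z x s \<epsilon> \<in> rel_interior (convex hull B)"
        unfolding rel_interior_simplex[OF B0(2)[OF TT0[OF B]]] using pos by blast
    qed
  qed
  \<comment> \<open>The simplex hit by the moving point could depend on \<epsilon>, so a finite
    choice only yields one that is hit frequently. Two hits already determine the line through
    \<open>x\<close> and \<open>w\<close>; hence both lie in the span of \<open>B\<close>, and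
    genericity makes \<open>B\<close> maximal. The conditions on the coordinates of \<open>x\<close>
    then follow from limits and from a single hit.\<close>
  have from_frequently: "B \<in> T \<and> x \<in> half_open_simplex B (K s B)"
    if B: "B \<in> T0" and fr: "frequently (\<lambda>\<epsilon>. z x s \<epsilon> \<in> rel_interior (convex hull B)) (at_right 0)" and s: "s \<noteq> 0"
    for x s B
  proof -
    have z: "z x s \<epsilon> = (1 - s * \<epsilon>) *\<^sub>R x + (s * \<epsilon>) *\<^sub>R w" for \<epsilon> by (simp add: z_def algebra_simps)
    have "frequently (\<lambda>\<epsilon>. z x s \<epsilon> \<in> rel_interior (convex hull B) \<and> 0 < \<epsilon>) (at_right 0)"
      using fr eventually_at_right_less by (rule frequently_eventually_frequently)
    then obtain \<epsilon>1 where \<epsilon>1: "0 < \<epsilon>1" "z x s \<epsilon>1 \<in> rel_interior (convex hull B)"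
      using frequently_ex by auto
    have "eventually (\<lambda>\<epsilon>. \<epsilon> < \<epsilon>1) (at_right 0)" using \<epsilon>1(1) by (rule order_tendstoD(2)[OF tendsto_ident_at])
    then have "frequently (\<lambda>\<epsilon>. z x s \<epsilon> \<in> rel_interior (convex hull B) \<and> \<epsilon> < \<epsilon>1) (at_right 0)"
      by (rule frequently_eventually_frequently[OF fr])
    then obtain \<epsilon>2 where \<epsilon>2: "\<epsilon>2 < \<epsilon>1" "z x s \<epsilon>2 \<in> rel_interior (convex hull B)"
      using frequently_ex by auto
    have sub: "rel_interior (convex hull B) \<subseteq> affine hull B"
      using rel_interior_subset convex_hull_subset_affine_hull by (rule subset_trans)
    have "(1 - r) *\<^sub>R x + r *\<^sub>R w \<in> affine hull B" for r
      by (rule affine_line[OF affine_affine_hull, of "s * \<epsilon>1" _ _ _ "s * \<epsilon>2"])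
         (use \<epsilon>1 \<epsilon>2 sub s in \<open>auto simp flip: z\<close>)
    from this[of 0] this[of 1] have aff: "x \<in> affine hull B" "w \<in> affine hull B" by simp_all
    have "aff_dim P \<le> aff_dim B" by (rule generic[OF B order_refl aff(2)])
    moreover have "aff_dim B \<le> aff_dim P" by (rule aff_dim_subset[OF B0(5)[OF B]])
    ultimately have BT: "B \<in> T" using B by (simp add: T_def)
    obtain u where u: "sum u B = 1" "lin_comb B u = x"
      using aff(1) unfolding affine_hull_finite[OF B0(3)[OF B]] lin_comb_def by blast
    have coords: "0 < (1 - s * \<epsilon>) * u b + (s * \<epsilon>) * \<beta> B b"
      if \<epsilon>: "z x s \<epsilon> \<in> rel_interior (convex hull B)" and b: "b \<in> B" for \<epsilon> b
    proof -
      obtain v where v: "z x s \<epsilon> = lin_comb B v" "\<forall>b\<in>B. 0 < v b" "sum v B = 1"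
        using \<epsilon> unfolding rel_interior_simplex[OF B0(2)[OF B]] by blast
      have "z x s \<epsilon> = lin_comb B (\<lambda>b. (1 - s * \<epsilon>) * u b + (s * \<epsilon>) * \<beta> B b)"
        using \<beta>[OF BT] lin_comb_affine[of B u "s * \<epsilon>" "\<beta> B"] u(2) by (simp add: z_def)
      moreover have "(\<Sum>b\<in>B. (1 - s * \<epsilon>) * u b + (s * \<epsilon>) * \<beta> B b) = 1"
        using \<beta>[OF BT] u(1) by (simp add: sum.distrib flip: sum_distrib_left)
      ultimately have "v b = (1 - s * \<epsilon>) * u b + (s * \<epsilon>) * \<beta> B b"
        using affine_independent_coords_unique[OF B0(2,3)[OF B], of v
            "\<lambda>b. (1 - s * \<epsilon>) * u b + (s * \<epsilon>) * \<beta> B b" b] v b by simp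
      moreover have "0 < v b" using v(2) b by simp
      ultimately show ?thesis by simp
    qed
    have "0 \<le> u b \<and> (b \<in> K s B \<longrightarrow> 0 < u b)" if b: "b \<in> B" for b
    proof -
      have "0 \<le> u b"
      proof (rule ccontr)
        assume "\<not> 0 \<le> u b"
        moreover have "((\<lambda>\<epsilon>. (1 - s * \<epsilon>) * u b + (s * \<epsilon>) * \<beta> B b) \<longlongrightarrow> (1 - s * 0) * u b + (s * 0) * \<beta> B b) (at_right 0)"
          by (intro tendsto_intros)
        ultimately have "eventually (\<lambda>\<epsilon>. (1 - s * \<epsilon>) * u b + (s * \<epsilon>) * \<beta> B b < 0) (at_right 0)"
          using order_tendstoD(2) by force
        then have "frequently (\<lambda>\<epsilon>. z x s \<epsilon> \<in> rel_interior (convex hull B) \<and>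
            (1 - s * \<epsilon>) * u b + (s * \<epsilon>) * \<beta> B b < 0) (at_right 0)"
          by (rule frequently_eventually_frequently[OF fr])
        then obtain \<epsilon> where "z x s \<epsilon> \<in> rel_interior (convex hull B)" "(1 - s * \<epsilon>) * u b + (s * \<epsilon>) * \<beta> B b < 0"
          using frequently_ex by blast
        then show False using coords[OF _ b] by fastforce
      qed
      moreover have "b \<notin> K s B" if "u b = 0"
      proof -
        have "0 < \<epsilon>1 * (s * \<beta> B b)" using coords[OF \<epsilon>1(2) b] that by (simp add: mult_ac)
        then have "0 < s * \<beta> B b" using \<epsilon>1(1) zero_less_mult_pos by blast
        then show ?thesis by (simp add: K_def)
      qed
      ultimately show ?thesis by force
    qed
    then have "x \<in> half_open_simplex B (K s B)"
      unfolding half_open_simplex_def using u by blast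
    then show ?thesis using BT by simp
  qed
  have nontriv: "at_right (0::real) \<noteq> bot" by simp
  have covered: "\<exists>B\<in>T. x \<in> half_open_simplex B (K s B)"
    if ev: "eventually (\<lambda>\<epsilon>. z x s \<epsilon> \<in> rel_interior P) (at_right 0)" and s: "s \<noteq> 0" for x s
  proof -
    have "eventually (\<lambda>\<epsilon>. \<exists>B\<in>T0. z x s \<epsilon> \<in> rel_interior (convex hull B)) (at_right 0)"
      using ev
    proof (rule eventually_mono)
      fix \<epsilon> assume "z x s \<epsilon> \<in> rel_interior P"
      from bspec[OF T0(3) this] show "\<exists>B\<in>T0. z x s \<epsilon> \<in> rel_interior (convex hull B)" by (auto elim: ex1E)
    qed
    then have "frequently (\<lambda>\<epsilon>. \<exists>B\<in>T0. z x s \<epsilon> \<in> rel_interior (convex hull B)) (at_right 0)"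
      by (rule eventually_frequently[OF nontriv])
    from frequently_bex_finite[OF T0(1) this]
    obtain B where "B \<in> T0" "frequently (\<lambda>\<epsilon>. z x s \<epsilon> \<in> rel_interior (convex hull B)) (at_right 0)"
      by (elim bexE)
    then show ?thesis using from_frequently s by blast
  qed
  have disj: "disjoint_family_on (\<lambda>B. half_open_simplex B (K s B)) T" if s: "s \<noteq> 0" for s
    unfolding disjoint_family_on_def
  proof (intro ballI impI equals0I)
    fix B1 B2 x assume B: "B1 \<in> T" "B2 \<in> T" "B1 \<noteq> B2"
      and x: "x \<in> half_open_simplex B1 (K s B1) \<inter> half_open_simplex B2 (K s B2)"
    have "eventually (\<lambda>\<epsilon>. z x s \<epsilon> \<in> rel_interior (convex hull B1) \<and> z x s \<epsilon> \<in> rel_interior (convex hull B2)) (at_right 0)"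
      using x by (intro eventually_conj enters B s) auto
    then obtain \<epsilon> where \<epsilon>: "z x s \<epsilon> \<in> rel_interior (convex hull B1)" "z x s \<epsilon> \<in> rel_interior (convex hull B2)"
      using eventually_happens'[OF nontriv] by blast
    have "z x s \<epsilon> \<in> rel_interior P" using \<epsilon>(1) B0(6)[OF TT0[OF B(1)]] by auto
    note bspec[OF T0(3) this]
    moreover have "B1 \<in> T0 \<and> z x s \<epsilon> \<in> rel_interior (convex hull B1)"
      "B2 \<in> T0 \<and> z x s \<epsilon> \<in> rel_interior (convex hull B2)"
      using \<epsilon> TT0 B by simp_all
    ultimately have "B1 = B2" by blast
    with B(3) show False ..
  qed
  have "P = (\<Union>B\<in>T. half_open_simplex B (K 1 B))"
  proof (intro equalityI subsetI)
    fix x assume x: "x \<in> P"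
    have "eventually (\<lambda>\<epsilon>::real. 0 < \<epsilon> \<and> \<epsilon> < 1) (at_right 0)"
      by (intro eventually_conj eventually_at_right_less order_tendstoD(2)[OF tendsto_ident_at]) simp
    then have "eventually (\<lambda>\<epsilon>. z x 1 \<epsilon> \<in> rel_interior P) (at_right 0)"
    proof (rule eventually_mono)
      fix \<epsilon> :: real assume "0 < \<epsilon> \<and> \<epsilon> < 1"
      then show "z x 1 \<epsilon> \<in> rel_interior P"
        using rel_interior_convex_shrink[OF cP(1) w(1) x, of \<epsilon>] by (simp add: z_def algebra_simps)
    qed
    then show "x \<in> (\<Union>B\<in>T. half_open_simplex B (K 1 B))" using covered[of x 1] by auto
  next
    fix x assume "x \<in> (\<Union>B\<in>T. half_open_simplex B (K 1 B))"
    then obtain B where B: "B \<in> T" "x \<in> half_open_simplex B (K 1 B)" by blast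
    then have "x \<in> convex hull B" using half_open_simplex_subset[OF B0(3)[OF TT0[OF B(1)]]] by auto
    moreover have "convex hull B \<subseteq> P" using B0(5)[OF TT0[OF B(1)]] cP by (intro hull_minimal)
    ultimately show "x \<in> P" by auto
  qed
  moreover have "rel_interior P = (\<Union>B\<in>T. half_open_simplex B (K (-1) B))"
  proof (intro equalityI subsetI)
    fix x assume x: "x \<in> rel_interior P"
    obtain U where U: "open U" "rel_interior P = affine hull P \<inter> U"
      using openin_rel_interior[of P] unfolding openin_open by blast
    have xP: "x \<in> affine hull P" using x U by simp
    have "(z x (-1) \<longlongrightarrow> x + (-1 * 0) *\<^sub>R (w - x)) (at_right 0)"
      unfolding z_def by (intro tendsto_intros)
    then have "eventually (\<lambda>\<epsilon>. z x (-1) \<epsilon> \<in> U) (at_right 0)"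
      using U x by (intro topological_tendstoD) auto
    then have "eventually (\<lambda>\<epsilon>. z x (-1) \<epsilon> \<in> rel_interior P) (at_right 0)"
    proof (rule eventually_mono)
      fix \<epsilon> assume "z x (-1) \<epsilon> \<in> U"
      moreover have "(1 + \<epsilon>) *\<^sub>R x + (- \<epsilon>) *\<^sub>R w \<in> affine hull P"
        using xP hull_inc[OF wP] by (intro mem_affine) auto
      ultimately show "z x (-1) \<epsilon> \<in> rel_interior P" using U by (simp add: z_def algebra_simps)
    qed
    then show "x \<in> (\<Union>B\<in>T. half_open_simplex B (K (-1) B))" using covered[of x "-1"] by auto
  next
    fix x assume "x \<in> (\<Union>B\<in>T. half_open_simplex B (K (-1) B))"
    then obtain B where B: "B \<in> T" "x \<in> half_open_simplex B (K (-1) B)" by blast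
    have "eventually (\<lambda>\<epsilon>. z x (-1) \<epsilon> \<in> rel_interior (convex hull B) \<and> 0 < \<epsilon>) (at_right 0)"
      by (intro eventually_conj eventually_at_right_less enters B) simp
    then obtain \<epsilon> where \<epsilon>: "z x (-1) \<epsilon> \<in> rel_interior (convex hull B)" "0 < \<epsilon>"
      using eventually_happens'[OF nontriv] by blast
    define y where "y = z x (-1) \<epsilon>"
    \<comment> \<open>As y - w = (1 + \<epsilon>) (x - w), shrinking \<open>y\<close> towards
      \<open>w\<close> by the factor with e (1 + \<epsilon>) = \<epsilon> returns exactly to
      \<open>x\<close>.\<close>
    define e where "e = \<epsilon> / (1 + \<epsilon>)"
    have e: "0 < e" "e \<le> 1" "e * (1 + \<epsilon>) = \<epsilon>" using \<epsilon>(2) by (auto simp: e_def field_simps)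
    have "y \<in> rel_interior P" using \<epsilon>(1) B0(6)[OF TT0[OF B(1)]] by (auto simp: y_def)
    then have "y \<in> P" using rel_interior_subset[of P] by auto
    then have "y - e *\<^sub>R (y - w) \<in> rel_interior P"
      using rel_interior_convex_shrink[OF cP(1) w(1) _ e(1,2)] by simp
    also have "y - e *\<^sub>R (y - w) = x + (\<epsilon> - e * (1 + \<epsilon>)) *\<^sub>R (x - w)"
      by (simp add: y_def z_def algebra_simps)
    finally show "x \<in> rel_interior P" unfolding e(3) by simp
  qed
  \<comment> \<open>The complement is exact because no coordinate of \<open>w\<close>
    vanishes.\<close>
  moreover have "K (-1) B = B - K 1 B" if "B \<in> T" for B
    using \<beta>0[OF that] by (force simp: K_def)
  moreover have "\<forall>B\<in>T. B \<noteq> {} \<and> \<not> affine_dependent B \<and> B \<subseteq> {x. x extreme_point_of P} \<and> int (card B) = aff_dim P + 1"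
  proof
    fix B assume B: "B \<in> T"
    have "int (card B) = aff_dim P + 1"
      using aff_dim_affine_independent[OF B0(2)[OF TT0[OF B]]] B by (simp add: T_def)
    then show "B \<noteq> {} \<and> \<not> affine_dependent B \<and> B \<subseteq> {x. x extreme_point_of P} \<and> int (card B) = aff_dim P + 1"
      using B0[OF TT0[OF B]] by simp
  qed
  ultimately show ?thesis
    using finT disj[of 1] disj[of "-1"]
    by (intro exI[of _ T] exI[of _ "K 1"]) (simp add: disjoint_family_on_def)
qed

section \<open>Weighted reciprocity and the Euler relation\<close>

text \<open>The half-open pieces are disjoint and all have the dimension of \<open>P\<close>, so
  their polynomials add up with one common sign. The complementary pieces fill the relative
  interior.\<close>

lemma weighted_reciprocity:
  fixes P :: "'a::euclidean_space set" and \<phi> :: "'a \<Rightarrow> complex"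
  assumes M: "discrete_subgroup M" and P: "polytope P" "P \<noteq> {}" "{x. x extreme_point_of P} \<subseteq> M"
    and \<phi>: "polyfun \<phi>"
  shows "\<exists>S. \<forall>q::nat. q > 0 \<longrightarrow>
    poly S (of_nat q) = (\<Sum>m\<in>M \<inter> (\<lambda>x. real q *\<^sub>R x) ` P. \<phi> m) \<and>
    poly S (- of_nat q) = (-1) ^ nat (aff_dim P) *
       (\<Sum>m\<in>M \<inter> (\<lambda>x. real q *\<^sub>R x) ` rel_interior P. \<phi> (- m))"
proof -
  obtain T J where T: "finite T"
    and T1: "\<forall>B\<in>T. B \<noteq> {} \<and> \<not> affine_dependent B \<and> B \<subseteq> {x. x extreme_point_of P} \<and> int (card B) = aff_dim P + 1"
    and PT: "P = (\<Union>B\<in>T. half_open_simplex B (J B))"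
      "disjoint_family_on (\<lambda>B. half_open_simplex B (J B)) T"
      "rel_interior P = (\<Union>B\<in>T. half_open_simplex B (B - J B))"
      "disjoint_family_on (\<lambda>B. half_open_simplex B (B - J B)) T"
    using half_open_decomposition[OF P(1,2)] by (elim exE conjE)
  have "\<exists>S. \<forall>q::nat. q > 0 \<longrightarrow>
    poly S (of_nat q) = (\<Sum>m\<in>M \<inter> (\<lambda>x. real q *\<^sub>R x) ` half_open_simplex B (J B). \<phi> m) \<and>
    poly S (- of_nat q) = (-1) ^ (card B - 1) *
       (\<Sum>m\<in>M \<inter> (\<lambda>x. real q *\<^sub>R x) ` half_open_simplex B (B - J B). \<phi> (- m))"
    if B: "B \<in> T" for B
  proof (rule half_open_simplex_reciprocity[OF M _ _ _ _ \<phi>])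
    from bspec[OF T1 B] show "B \<noteq> {}" "\<not> affine_dependent B" "B \<subseteq> M" using P(3) by auto
    then show "finite B" by (simp add: aff_independent_finite)
  qed
  then obtain S where S: "\<And>B q. B \<in> T \<Longrightarrow> q > 0 \<Longrightarrow>
    poly (S B) (of_nat q) = (\<Sum>m\<in>M \<inter> (\<lambda>x. real q *\<^sub>R x) ` half_open_simplex B (J B). \<phi> m) \<and>
    poly (S B) (- of_nat q) = (-1) ^ (card B - 1) *
       (\<Sum>m\<in>M \<inter> (\<lambda>x. real q *\<^sub>R x) ` half_open_simplex B (B - J B). \<phi> (- m))"
    by metis
  have decompose: "(\<Sum>m\<in>M \<inter> (\<lambda>x. real q *\<^sub>R x) ` (\<Union>B\<in>T. H B). f m) =
      (\<Sum>B\<in>T. \<Sum>m\<in>M \<inter> (\<lambda>x. real q *\<^sub>R x) ` H B. f m)"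
    if q: "q > 0" and H: "disjoint_family_on H T" "(\<Union>B\<in>T. H B) \<subseteq> P"
    for q :: nat and H :: "'a set \<Rightarrow> 'a set" and f :: "'a \<Rightarrow> complex"
  proof -
    have eq: "M \<inter> (\<lambda>x. real q *\<^sub>R x) ` (\<Union>B\<in>T. H B) = (\<Union>B\<in>T. M \<inter> (\<lambda>x. real q *\<^sub>R x) ` H B)"
      by (simp only: image_UN Int_UN_distrib)
    have "bounded ((\<lambda>x. real q *\<^sub>R x) ` H B)" if "B \<in> T" for B
    proof -
      have "bounded P" using P(1) by (rule polytope_imp_bounded)
      then have "bounded (H B)" by (rule bounded_subset) (use H(2) that in auto)
      then show ?thesis by (rule bounded_scaling)
    qed
    then have "\<forall>B\<in>T. finite (M \<inter> (\<lambda>x. real q *\<^sub>R x) ` H B)"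
      using M by (simp add: discrete_subgroup_def)
    moreover have "(M \<inter> (\<lambda>x. real q *\<^sub>R x) ` H B) \<inter> (M \<inter> (\<lambda>x. real q *\<^sub>R x) ` H B') = {}"
      if "B \<in> T" "B' \<in> T" "B \<noteq> B'" for B B'
    proof -
      have "H B \<inter> H B' = {}" using disjoint_family_onD[OF H(1) that] .
      moreover have "inj (\<lambda>x::'a. real q *\<^sub>R x)" using q by (simp add: inj_on_def)
      ultimately have "(\<lambda>x. real q *\<^sub>R x) ` H B \<inter> (\<lambda>x. real q *\<^sub>R x) ` H B' = {}"
        by (metis image_Int image_empty)
      then show ?thesis by blast
    qed
    ultimately show ?thesis unfolding eq using T by (intro sum.UNION_disjoint) auto
  qed
  have sgn: "card B - 1 = nat (aff_dim P)" if "B \<in> T" for B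
    using bspec[OF T1 that] by linarith
  show ?thesis
  proof (intro exI[of _ "\<Sum>B\<in>T. S B"] allI impI conjI)
    fix q :: nat assume q: "q > 0"
    show "poly (\<Sum>B\<in>T. S B) (of_nat q) = (\<Sum>m\<in>M \<inter> (\<lambda>x. real q *\<^sub>R x) ` P. \<phi> m)"
    proof -
      have "(\<Union>B\<in>T. half_open_simplex B (J B)) \<subseteq> P" using PT(1) by (rule equalityD2)
      from decompose[OF q PT(2) this, of \<phi>, folded PT(1)] show ?thesis
        using S[OF _ q] by (simp add: poly_sum)
    qed
    show "poly (\<Sum>B\<in>T. S B) (- of_nat q) = (-1) ^ nat (aff_dim P) *
       (\<Sum>m\<in>M \<inter> (\<lambda>x. real q *\<^sub>R x) ` rel_interior P. \<phi> (- m))"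
    proof -
      have "(\<Union>B\<in>T. half_open_simplex B (B - J B)) \<subseteq> P"
        using rel_interior_subset[of P] unfolding PT(3)[symmetric] .
      from decompose[OF q PT(4) this, of "\<lambda>m. \<phi> (- m)", folded PT(3)] show ?thesis
        using S[OF _ q] sgn by (simp add: poly_sum sum_distrib_left)
    qed
  qed
qed

lemma poly_eq_if_agree_on_pos_nat:
  fixes p r :: "complex poly"
  assumes "\<And>q::nat. q > 0 \<Longrightarrow> poly p (of_nat q) = poly r (of_nat q)"
  shows "p = r"
proof (rule ccontr)
  assume "p \<noteq> r"
  then have "finite {x. poly (p - r) x = 0}" by (intro poly_roots_finite) simp
  moreover have "of_nat ` {0<..} \<subseteq> {x. poly (p - r) x = 0}" using assms by auto
  ultimately have "finite (of_nat ` {0::nat<..} :: complex set)" by (rule finite_subset[rotated])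
  then have "finite {0::nat<..}" by (rule finite_imageD) (simp add: inj_on_def)
  then show False by (simp add: infinite_Ioi)
qed

section \<open>Faces, their relative interiors and Euler relations\<close>

definition nonempty_faces :: "'a::real_vector set \<Rightarrow> 'a set set" where
  "nonempty_faces P = {F. F face_of P \<and> F \<noteq> {}}"

lemma finite_nonempty_faces:
  fixes P :: "'a::euclidean_space set"
  shows "polytope P \<Longrightarrow> finite (nonempty_faces P)"
  unfolding nonempty_faces_def by (rule finite_subset[OF _ finite_polytope_faces]) auto

lemma sum_over_face_interiors:
  fixes P :: "'a::euclidean_space set" and f :: "'a \<Rightarrow> complex"
  assumes M: "discrete_subgroup M" and P: "polytope P" and q: "q > 0"
  shows "(\<Sum>m\<in>M \<inter> (\<lambda>x. real q *\<^sub>R x) ` P. f m) =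
    (\<Sum>F\<in>nonempty_faces P. \<Sum>m\<in>M \<inter> (\<lambda>x. real q *\<^sub>R x) ` rel_interior F. f m)"
proof -
  have sub: "rel_interior F \<subseteq> P" if "F \<in> nonempty_faces P" for F
    using that rel_interior_subset[of F] face_of_imp_subset[of F P] by (auto simp: nonempty_faces_def)
  have eq: "P = (\<Union>F\<in>nonempty_faces P. rel_interior F)"
  proof (intro equalityI subsetI)
    fix x assume "x \<in> P"
    then obtain F where "F face_of P" "x \<in> rel_interior F"
      using polytope_point_in_face_interior[OF P] by auto
    moreover from this have "F \<noteq> {}" by auto
    ultimately show "x \<in> (\<Union>F\<in>nonempty_faces P. rel_interior F)" by (auto simp: nonempty_faces_def)
  qed (use sub in auto)
  have "bounded ((\<lambda>x. real q *\<^sub>R x) ` P)" using polytope_imp_bounded[OF P] by (rule bounded_scaling)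
  then have finP: "finite (M \<inter> (\<lambda>x. real q *\<^sub>R x) ` P)" using M by (simp add: discrete_subgroup_def)
  have "M \<inter> (\<lambda>x. real q *\<^sub>R x) ` (\<Union>F\<in>nonempty_faces P. rel_interior F)
      = (\<Union>F\<in>nonempty_faces P. M \<inter> (\<lambda>x. real q *\<^sub>R x) ` rel_interior F)"
    by (simp only: image_UN Int_UN_distrib)
  then have eq': "M \<inter> (\<lambda>x. real q *\<^sub>R x) ` P = (\<Union>F\<in>nonempty_faces P. M \<inter> (\<lambda>x. real q *\<^sub>R x) ` rel_interior F)"
    unfolding eq[symmetric] .
  have "finite (M \<inter> (\<lambda>x. real q *\<^sub>R x) ` rel_interior F)" if "F \<in> nonempty_faces P" for F
    by (rule finite_subset[OF _ finP]) (use sub[OF that] in auto)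
  moreover have "(M \<inter> (\<lambda>x. real q *\<^sub>R x) ` rel_interior F) \<inter> (M \<inter> (\<lambda>x. real q *\<^sub>R x) ` rel_interior G) = {}"
    if FG: "F \<in> nonempty_faces P" "G \<in> nonempty_faces P" "F \<noteq> G" for F G
  proof -
    have "rel_interior F \<inter> rel_interior G = {}"
      using FG face_of_eq[of F P G] by (auto simp: nonempty_faces_def)
    then show ?thesis using q by (auto simp: mem_scaled_image)
  qed
  ultimately show ?thesis
    unfolding eq' using finite_nonempty_faces[OF P] by (intro sum.UNION_disjoint) auto
qed

lemma face_extreme_points_subset:
  assumes "{x. x extreme_point_of P} \<subseteq> M" "F face_of P"
  shows "{x. x extreme_point_of F} \<subseteq> M"
  using assms extreme_point_of_face[OF assms(2)] by auto

lemma nonempty_faces_D: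
  fixes P :: "'a::euclidean_space set"
  assumes "polytope P" "F \<in> nonempty_faces P"
  shows "F face_of P" "F \<noteq> {}" "polytope F" "F \<subseteq> P" "0 \<le> aff_dim F" "aff_dim F \<le> aff_dim P"
proof -
  show F: "F face_of P" "F \<noteq> {}" using assms by (auto simp: nonempty_faces_def)
  show "polytope F" using assms(1) F face_of_polytope_polytope by auto
  show "F \<subseteq> P" using F by (simp add: face_of_imp_subset)
  then show "aff_dim F \<le> aff_dim P" by (rule aff_dim_subset)
  show "0 \<le> aff_dim F" using F(2) by (metis aff_dim_negative_iff not_le)
qed

text \<open>Substituting -q into the decomposition of the counting polynomial over the relative
  interiors of the faces.\<close>

lemma weighted_euler_relation:
  fixes P :: "'a::euclidean_space set" and \<phi> :: "'a \<Rightarrow> complex"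
  assumes M: "discrete_subgroup M" and P: "polytope P" "P \<noteq> {}" "{x. x extreme_point_of P} \<subseteq> M"
    and \<phi>: "polyfun \<phi>" and q: "q > 0"
  shows "(\<Sum>F\<in>nonempty_faces P. (-1) ^ nat (aff_dim F) * (\<Sum>m\<in>M \<inter> (\<lambda>x. real q *\<^sub>R x) ` F. \<phi> m)) =
    (-1) ^ nat (aff_dim P) * (\<Sum>m\<in>M \<inter> (\<lambda>x. real q *\<^sub>R x) ` rel_interior P. \<phi> m)"
proof -
  \<comment> \<open>Reciprocity negates the lattice points. Counting \<open>P\<close> with the
    weight at -m therefore brings back \<phi> itself when -q is substituted.\<close>
  have \<phi>': "polyfun (\<lambda>m. \<phi> (- m))" using \<phi> by (rule polyfun_uminus)
  obtain D where D: "\<And>q::nat. q > 0 \<Longrightarrow>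
    poly D (of_nat q) = (\<Sum>m\<in>M \<inter> (\<lambda>x. real q *\<^sub>R x) ` P. \<phi> (- m)) \<and>
    poly D (- of_nat q) = (-1) ^ nat (aff_dim P) *
       (\<Sum>m\<in>M \<inter> (\<lambda>x. real q *\<^sub>R x) ` rel_interior P. \<phi> m)"
    using weighted_reciprocity[OF M P \<phi>'] by auto
  have "\<exists>S. \<forall>q::nat. q > 0 \<longrightarrow>
    poly S (of_nat q) = (\<Sum>m\<in>M \<inter> (\<lambda>x. real q *\<^sub>R x) ` F. \<phi> m) \<and>
    poly S (- of_nat q) = (-1) ^ nat (aff_dim F) *
       (\<Sum>m\<in>M \<inter> (\<lambda>x. real q *\<^sub>R x) ` rel_interior F. \<phi> (- m))" if F: "F \<in> nonempty_faces P" for F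
    by (rule weighted_reciprocity[OF M nonempty_faces_D(3,2)[OF P(1) F] face_extreme_points_subset[OF P(3) nonempty_faces_D(1)[OF P(1) F]] \<phi>])
  then obtain E where E: "\<And>F q. F \<in> nonempty_faces P \<Longrightarrow> q > 0 \<Longrightarrow>
    poly (E F) (of_nat q) = (\<Sum>m\<in>M \<inter> (\<lambda>x. real q *\<^sub>R x) ` F. \<phi> m) \<and>
    poly (E F) (- of_nat q) = (-1) ^ nat (aff_dim F) *
       (\<Sum>m\<in>M \<inter> (\<lambda>x. real q *\<^sub>R x) ` rel_interior F. \<phi> (- m))" by metis
  \<comment> \<open>The decomposition into interiors is known only at positive integers, where each
    interior sum is a signed value of \<open>E F\<close> at -q. Only as an identity of polynomials
    can it be evaluated at -q.\<close>
  have "D = (\<Sum>F\<in>nonempty_faces P. smult ((-1) ^ nat (aff_dim F)) (pcompose (E F) [:0, -1:]))"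
  proof (rule poly_eq_if_agree_on_pos_nat)
    fix q :: nat assume q: "q > 0"
    have "poly D (of_nat q) = (\<Sum>F\<in>nonempty_faces P. \<Sum>m\<in>M \<inter> (\<lambda>x. real q *\<^sub>R x) ` rel_interior F. \<phi> (- m))"
      using D[OF q] sum_over_face_interiors[OF M P(1) q, of "\<lambda>m. \<phi> (- m)"] by simp
    also have "\<dots> = (\<Sum>F\<in>nonempty_faces P. (-1) ^ nat (aff_dim F) * poly (E F) (- of_nat q))"
      using E[OF _ q] by (intro sum.cong) (simp_all add: mult.assoc[symmetric] flip: power_mult_distrib)
    finally show "poly D (of_nat q) = poly (\<Sum>F\<in>nonempty_faces P. smult ((-1) ^ nat (aff_dim F)) (pcompose (E F) [:0, -1:])) (of_nat q)"
      by (simp add: poly_sum poly_pcompose)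
  qed
  then have "poly D (- of_nat q) = (\<Sum>F\<in>nonempty_faces P. (-1) ^ nat (aff_dim F) * poly (E F) (of_nat q))"
    by (simp add: poly_sum poly_pcompose)
  then show ?thesis using D[OF q] E[OF _ q] by simp
qed

text \<open>For each other point a, the affine form taking x to the inner product of m - a and x - a
  vanishes at a and is positive at \<open>m\<close>. The normalised product of these forms separates
  \<open>m\<close>.\<close>

lemma polyfun_separating:
  fixes m :: "'a::euclidean_space"
  assumes "finite A"
  shows "\<exists>\<phi>. polyfun \<phi> \<and> \<phi> m = 1 \<and> (\<forall>x\<in>A. x \<noteq> m \<longrightarrow> \<phi> x = 0)"
proof -
  define f where "f a x = complex_of_real (inner (m - a) x) + complex_of_real (- inner (m - a) a)" for a x
  define \<phi> where "\<phi> x = (1 / (\<Prod>a\<in>A - {m}. f a m)) * (\<Prod>a\<in>A - {m}. f a x)" for x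
  have "linear (\<lambda>x. inner (m - a) x)" for a
    by (simp add: bounded_linear.linear bounded_linear_inner_right)
  then have "polyfun (f a)" for a
    unfolding f_def by (intro polyfun.add polyfun.linear polyfun.const)
  then have "polyfun \<phi>"
    unfolding \<phi>_def using assms by (intro polyfun.mult polyfun.const polyfun_prod) auto
  moreover have "f a m = complex_of_real (inner (m - a) (m - a))" for a
    by (simp add: f_def inner_diff_right)
  then have "(\<Prod>a\<in>A - {m}. f a m) \<noteq> 0" using assms by simp
  then have "\<phi> m = 1" by (simp add: \<phi>_def)
  moreover have "\<phi> x = 0" if "x \<in> A" "x \<noteq> m" for x
  proof -
    have "f x x = 0" by (simp add: f_def)
    then have "(\<Prod>a\<in>A - {m}. f a x) = 0" using assms that by (intro prod_zero) auto
    then show ?thesis by (simp add: \<phi>_def)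
  qed
  ultimately show ?thesis by blast
qed

text \<open>Polynomial weights separate lattice points, so the weighted relation localises at the
  barycentre of the vertices of G, a rational point in the relative interior of G.\<close>

lemma euler_relation_interval:
  fixes P :: "'a::euclidean_space set"
  assumes M: "discrete_subgroup M" and P: "polytope P" "{x. x extreme_point_of P} \<subseteq> M"
    and G: "G \<in> nonempty_faces P"
  shows "(\<Sum>F\<in>{F. F face_of P \<and> G \<subseteq> F}. (-1) ^ nat (aff_dim F) :: complex) =
    (if G = P then (-1) ^ nat (aff_dim P) else 0)"
proof -
  note G' = nonempty_faces_D[OF P(1) G]
  define V where "V = {x. x extreme_point_of G}"
  have GV: "G = convex hull V"
    unfolding V_def using Krein_Milman_Minkowski[of G] G'(3) polytope_imp_compact polytope_imp_convex by auto
  have finV: "finite V" unfolding V_def using finite_polyhedron_extreme_points[OF polytope_imp_polyhedron[OF G'(3)]] .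
  have V0: "V \<noteq> {}" using GV G'(2) by auto
  have VM: "V \<subseteq> M" unfolding V_def by (rule face_extreme_points_subset[OF P(2) G'(1)])
  \<comment> \<open>Dilating by the number of vertices turns their barycentre into their sum, which
    is a point of \<open>M\<close>.\<close>
  define q where "q = card V"
  have q: "q > 0" using finV V0 by (simp add: q_def card_gt_0_iff)
  define m where "m = (\<Sum>v\<in>V. v)"
  have mM: "m \<in> M" unfolding m_def using VM by (intro discrete_subgroup_sum[OF M]) auto
  have m_ri: "(1 / real q) *\<^sub>R m \<in> rel_interior G"
  proof -
    have "(\<Sum>v\<in>V. (1 / real q) *\<^sub>R v) \<in> rel_interior (convex hull V)"
      using q q_def
      by (intro subsetD[OF explicit_subset_rel_interior_convex_hull_minimal[OF finV]])
         (auto intro!: exI[of _ "\<lambda>_. 1 / real q"])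
    then show ?thesis by (simp add: m_def scaleR_sum_right flip: GV)
  qed
  \<comment> \<open>A face meeting the relative interior of \<open>G\<close> contains all of
    \<open>G\<close>; so testing at the barycentre selects the faces above \<open>G\<close>.\<close>
  have mem: "(1 / real q) *\<^sub>R m \<in> F \<longleftrightarrow> G \<subseteq> F" if "F face_of P" for F
    using subset_of_face_of[OF that G'(4)] m_ri rel_interior_subset[of G] by auto
  have memri: "(1 / real q) *\<^sub>R m \<in> rel_interior P \<longleftrightarrow> G = P"
    using face_of_disjoint_rel_interior[OF G'(1)] m_ri rel_interior_subset[of G] by auto
  have P0: "P \<noteq> {}" using G'(2,4) by auto
  have "bounded ((\<lambda>x. real q *\<^sub>R x) ` P)" using polytope_imp_bounded[OF P(1)] by (rule bounded_scaling)
  then have finP: "finite (M \<inter> (\<lambda>x. real q *\<^sub>R x) ` P)" using M by (simp add: discrete_subgroup_def)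
  obtain \<phi> where \<phi>: "polyfun \<phi>" "\<phi> m = 1" "\<forall>x\<in>M \<inter> (\<lambda>x. real q *\<^sub>R x) ` P. x \<noteq> m \<longrightarrow> \<phi> x = 0"
    using polyfun_separating[OF finP] by blast
  have local: "(\<Sum>x\<in>M \<inter> (\<lambda>x. real q *\<^sub>R x) ` X. \<phi> x) = (if (1 / real q) *\<^sub>R m \<in> X then 1 else 0)"
    if "X \<subseteq> P" for X
  proof -
    have fin: "finite (M \<inter> (\<lambda>x. real q *\<^sub>R x) ` X)"
      by (rule finite_subset[OF _ finP]) (use that in auto)
    have "\<phi> x = (if x = m then 1 else 0)" if "x \<in> M \<inter> (\<lambda>x. real q *\<^sub>R x) ` X" for x
      using that \<open>X \<subseteq> P\<close> \<phi> by auto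
    then have "(\<Sum>x\<in>M \<inter> (\<lambda>x. real q *\<^sub>R x) ` X. \<phi> x) = (\<Sum>x\<in>M \<inter> (\<lambda>x. real q *\<^sub>R x) ` X. if x = m then 1 else 0)"
      by (intro sum.cong) auto
    also have "\<dots> = (if m \<in> M \<inter> (\<lambda>x. real q *\<^sub>R x) ` X then 1 else 0)"
      using fin by (rule sum.delta)
    also have "\<dots> = (if (1 / real q) *\<^sub>R m \<in> X then 1 else 0)"
      using mM q by (simp add: mem_scaled_image)
    finally show ?thesis .
  qed
  have "(\<Sum>F\<in>{F. F face_of P \<and> G \<subseteq> F}. (-1) ^ nat (aff_dim F) :: complex)
     = (\<Sum>F\<in>nonempty_faces P. (-1) ^ nat (aff_dim F) * (if (1 / real q) *\<^sub>R m \<in> F then 1 else 0))"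
    using finite_nonempty_faces[OF P(1)] G'(2)
    by (intro sum.mono_neutral_cong_left) (auto simp: mem nonempty_faces_def)
  also have "\<dots> = (\<Sum>F\<in>nonempty_faces P. (-1) ^ nat (aff_dim F) * (\<Sum>x\<in>M \<inter> (\<lambda>x. real q *\<^sub>R x) ` F. \<phi> x))"
    using nonempty_faces_D(4)[OF P(1)] by (intro sum.cong) (simp_all add: local)
  also have "\<dots> = (-1) ^ nat (aff_dim P) * (if (1 / real q) *\<^sub>R m \<in> rel_interior P then 1 else 0)"
    using weighted_euler_relation[OF M P(1) P0 P(2) \<phi>(1) q] rel_interior_subset[of P] by (simp add: local)
  finally show ?thesis by (simp add: memri)
qed

section \<open>Duality of the g-polynomials\<close>

text \<open>This identifies \<open>g_trunc k f\<close> as (1 - x) f cut off above degree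
  \<open>k div 2\<close>.\<close>

lemma coeff_one_minus_x_mult:
  "coeff ([:1, -1:] * f) l = coeff f l - (if l = 0 then 0 else coeff f (l - 1) :: complex)"
  by (cases l) (simp_all add: coeff_pCons)

lemma poly_eq_sum_of_degree_le:
  fixes p :: "complex poly"
  assumes "degree p \<le> N"
  shows "poly p x = (\<Sum>l\<le>N. coeff p l * x ^ l)"
  unfolding poly_altdef using assms by (intro sum.mono_neutral_left) (auto simp: coeff_eq_0)

lemma antipalindromic_coeffs:
  fixes A :: "complex poly"
  assumes "degree A \<le> N" "\<And>x. x \<noteq> 0 \<Longrightarrow> x ^ N * poly A (1 / x) = - poly A x" "l \<le> N"
  shows "coeff A (N - l) = - coeff A l"
proof -
  define R where "R = (\<Sum>l\<le>N. monom (coeff A (N - l)) l)"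
  have "poly R x = - poly A x" if x: "x \<noteq> 0" for x
  proof -
    have "x ^ N * poly A (1 / x) = (\<Sum>l\<le>N. coeff A l * x ^ (N - l))"
      unfolding poly_eq_sum_of_degree_le[OF assms(1)] sum_distrib_left
      using x by (intro sum.cong) (auto simp: power_diff field_simps)
    also have "\<dots> = (\<Sum>l\<le>N. coeff A (N - l) * x ^ l)"
      by (rule sum.reindex_bij_witness[of _ "\<lambda>l. N - l" "\<lambda>l. N - l"]) auto
    finally show ?thesis using assms(2)[OF x] by (simp add: R_def poly_sum poly_monom)
  qed
  then have "R = - A" by (intro poly_eq_if_agree_on_pos_nat) simp
  moreover have "coeff R l = coeff A (N - l)"
    using assms(3) by (simp add: R_def coeff_sum)
  ultimately show ?thesis by simp
qed

text \<open>(1 - x) f is antipalindromic of formal degree k + 1. Its lower half is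
  \<open>g_trunc k f\<close>, and its upper half is minus the reflection of that; a middle
  coefficient, if there is one, is zero.\<close>

lemma g_trunc_reflection:
  fixes f :: "complex poly"
  assumes "degree f \<le> k"
    and anti: "\<And>x. x \<noteq> 0 \<Longrightarrow> x ^ Suc k * poly ([:1, -1:] * f) (1 / x) = - poly ([:1, -1:] * f) x"
    and x: "x \<noteq> 0"
  shows "poly (g_trunc k f) x - x ^ Suc k * poly (g_trunc k f) (1 / x) = poly ([:1, -1:] * f) x"
proof -
  define A where "A = [:1, -1:] * f"
  have deg: "degree A \<le> Suc k"
    unfolding A_def using degree_mult_le[of "[:1, -1:]" f] assms(1) by simp
  have sym: "coeff A (Suc k - l) = - coeff A l" if "l \<le> Suc k" for l
    by (rule antipalindromic_coeffs[OF deg _ that]) (use anti in \<open>simp add: A_def\<close>)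
  have g: "poly (g_trunc k f) z = (\<Sum>l\<in>{0..k div 2}. coeff A l * z ^ l)" for z
    unfolding g_trunc_def A_def coeff_one_minus_x_mult by (simp add: poly_sum poly_monom)
  have "x ^ Suc k * poly (g_trunc k f) (1 / x) = (\<Sum>l\<in>{0..k div 2}. coeff A l * x ^ (Suc k - l))"
    unfolding g sum_distrib_left using x by (intro sum.cong) (auto simp: power_diff field_simps)
  also have "\<dots> = (\<Sum>l\<in>{Suc k - k div 2..Suc k}. coeff A (Suc k - l) * x ^ l)"
    by (rule sum.reindex_bij_witness[of _ "\<lambda>l. Suc k - l" "\<lambda>l. Suc k - l"]) auto
  also have "\<dots> = - (\<Sum>l\<in>{Suc k - k div 2..Suc k}. coeff A l * x ^ l)"
    by (simp add: sym flip: sum_negf)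
  finally have "poly (g_trunc k f) x - x ^ Suc k * poly (g_trunc k f) (1 / x)
     = (\<Sum>l\<in>{0..k div 2}. coeff A l * x ^ l) + (\<Sum>l\<in>{Suc k - k div 2..Suc k}. coeff A l * x ^ l)"
    by (simp add: g)
  also have "\<dots> = (\<Sum>l\<in>{0..k div 2} \<union> {Suc k - k div 2..Suc k}. coeff A l * x ^ l)"
    by (rule sum.union_disjoint[symmetric]) auto
  also have "\<dots> = (\<Sum>l\<le>Suc k. coeff A l * x ^ l)"
  proof (rule sum.mono_neutral_left)
    show "\<forall>l\<in>{..Suc k} - ({0..k div 2} \<union> {Suc k - k div 2..Suc k}). coeff A l * x ^ l = 0"
    proof
      fix l assume "l \<in> {..Suc k} - ({0..k div 2} \<union> {Suc k - k div 2..Suc k})"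
      then have "k div 2 < l" "l < Suc k - k div 2" "l \<le> Suc k" by auto
      \<comment> \<open>Only an odd \<open>k\<close> leaves an index between the two halves. It is
        the centre of symmetry, so its coefficient equals its own negative.\<close>
      then have "Suc k - l = l" by presburger
      with sym[OF \<open>l \<le> Suc k\<close>] show "coeff A l * x ^ l = 0" by simp
    qed
  qed auto
  also have "\<dots> = poly A x" by (rule poly_eq_sum_of_degree_le[OF deg, symmetric])
  finally show ?thesis by (simp add: A_def)
qed

section \<open>Codimension, fuel and the recursion for the g-polynomials of dual faces\<close>

definition codim_in :: "(real^'n) set \<Rightarrow> (real^'n) set \<Rightarrow> nat" where
  "codim_in P F = nat (aff_dim P - aff_dim F)"

lemma codim_in_add:
  assumes P: "polytope P" and "F \<in> nonempty_faces P" "G \<in> nonempty_faces P" "F \<subseteq> G"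
  shows "codim_in P F = codim_in P G + codim_in G F"
  using nonempty_faces_D(6)[OF P assms(3)] aff_dim_subset[OF assms(4)] by (simp add: codim_in_def)

lemma codim_in_pos:
  assumes P: "polytope P" and F: "F \<in> nonempty_faces P" and G: "G \<in> nonempty_faces P" and FG: "F \<subset> G"
  shows "0 < codim_in G F"
proof -
  have "F face_of G"
    using nonempty_faces_D(1)[OF P F] face_of_face[OF nonempty_faces_D(1)[OF P G]] FG
    by (meson face_of_imp_subset face_of_subset nonempty_faces_D(4)[OF P G] psubset_imp_subset)
  then have "aff_dim F < aff_dim G"
    using FG face_of_aff_dim_lt[of G F] polytope_imp_convex[OF nonempty_faces_D(3)[OF P G]] by auto
  then show ?thesis by (simp add: codim_in_def)
qed

lemma nonempty_faces_above:
  assumes "F \<in> nonempty_faces P"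
  shows "{G. G face_of P \<and> F \<subset> G} = {G \<in> nonempty_faces P. F \<subset> G}"
  using assms by (auto simp: nonempty_faces_def)

text \<open>Each recursive call moves to a strictly larger face and so lowers the codimension. With
  fuel above the codimension, the default value at fuel 0 is never consulted.\<close>

lemma gdual_fuel_stable:
  assumes P: "polytope P"
  shows "F \<in> nonempty_faces P \<Longrightarrow> codim_in P F \<le> r \<Longrightarrow> codim_in P F \<le> r' \<Longrightarrow>
    gdual_fuel (Suc r) P F = gdual_fuel (Suc r') P F"
proof (induction "codim_in P F" arbitrary: F r r' rule: less_induct)
  case less
  note F = less.prems(1)
  show ?case
  proof (cases "F = P")
    case False
    then have FP: "F \<subset> P" using nonempty_faces_D(4)[OF P F] by auto
    have PP: "P \<in> nonempty_faces P"
      using P F FP by (auto simp: nonempty_faces_def face_of_refl polytope_imp_convex)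
    have "0 < codim_in P F" by (rule codim_in_pos[OF P F PP FP])
    then obtain s s' where s: "r = Suc s" "r' = Suc s'" using less.prems
      by (metis Suc_le_D less_le_trans gr0_conv_Suc)
    have "gdual_fuel r P G = gdual_fuel r' P G" if G: "G \<in> {G. G face_of P \<and> F \<subset> G}" for G
    proof -
      have G': "G \<in> nonempty_faces P" "F \<subset> G" using that unfolding nonempty_faces_above[OF F] by auto
      have "codim_in P G < codim_in P F"
        using codim_in_add[OF P F G'(1)] codim_in_pos[OF P F G'] G'(2) by auto
      then show ?thesis unfolding s using less.prems s by (intro less.hyps G'(1)) auto
    qed
    then have "(\<Sum>G\<in>{G. G face_of P \<and> F \<subset> G}. gdual_fuel r P G * [:-1, 1:] ^ nat (aff_dim G - aff_dim F - 1))
      = (\<Sum>G\<in>{G. G face_of P \<and> F \<subset> G}. gdual_fuel r' P G * [:-1, 1:] ^ nat (aff_dim G - aff_dim F - 1))"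
      by (intro sum.cong) auto
    then show ?thesis using False by simp
  qed simp
qed

text \<open>The f-polynomial of the dual face of \<open>F\<close>. That face has dimension k =
  \<open>codim_in P F - 1\<close>, and its proper face dual to \<open>G\<close> has dimension
  \<open>codim_in P G - 1\<close>, so the exponent k - 1 - dim becomes
  \<open>codim_in G F - 1\<close>.\<close>

definition fdual :: "(real^'n) set \<Rightarrow> (real^'n) set \<Rightarrow> complex poly" where
  "fdual P F = (\<Sum>G\<in>{G \<in> nonempty_faces P. F \<subset> G}. gtilde P G * [:-1, 1:] ^ (codim_in G F - 1))"

lemma gtilde_rec:
  assumes P: "polytope P" and F: "F \<in> nonempty_faces P"
  shows "gtilde P F = (if F = P then 1 else g_trunc (codim_in P F - 1) (fdual P F))"
proof -
  have le: "codim_in P G \<le> nat (aff_dim P)" if "G \<in> nonempty_faces P" for G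
    using nonempty_faces_D(5)[OF P that] by (simp add: codim_in_def)
  \<comment> \<open>The recursive calls run with one unit of fuel less than \<open>gtilde\<close>
    supplies. A face strictly above a nonempty face has codimension less than the dimension of
    \<open>P\<close>, so this is still enough.\<close>
  have "gdual_fuel (nat (aff_dim P)) P G = gtilde P G" if G: "G \<in> nonempty_faces P" "F \<subset> G" for G
  proof -
    have "codim_in P G < nat (aff_dim P)"
      using codim_in_add[OF P F G(1)] codim_in_pos[OF P F G] G(2) le[OF F] by auto
    then obtain r where r: "nat (aff_dim P) = Suc r" "codim_in P G \<le> r" by (cases "nat (aff_dim P)") auto
    show ?thesis
      unfolding gtilde_def r(1) by (rule gdual_fuel_stable[OF P G(1)]) (use r in auto)
  qed
  moreover have exponent: "nat (aff_dim G - aff_dim F - 1) = codim_in G F - 1" for G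
    unfolding codim_in_def by linarith
  ultimately have "(\<Sum>G\<in>{G. G face_of P \<and> F \<subset> G}. gdual_fuel (nat (aff_dim P)) P G * [:-1, 1:] ^ nat (aff_dim G - aff_dim F - 1))
     = fdual P F"
    unfolding fdual_def nonempty_faces_above[OF F]
    by (intro sum.cong) auto
  then show ?thesis
    unfolding gtilde_def by (simp add: exponent)
qed

lemma degree_g_trunc: "degree (g_trunc k f) \<le> k div 2"
  unfolding g_trunc_def by (intro degree_sum_le) (auto intro: order_trans[OF degree_monom_le])

lemma degree_gtilde:
  assumes "polytope P" "F \<in> nonempty_faces P"
  shows "degree (gtilde P F) \<le> codim_in P F"
  unfolding gtilde_rec[OF assms] using degree_g_trunc[of "codim_in P F - 1" "fdual P F"] by auto

lemma degree_fdual: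
  assumes P: "polytope P" and F: "F \<in> nonempty_faces P"
  shows "degree (fdual P F) \<le> codim_in P F - 1"
  unfolding fdual_def
proof (rule degree_sum_le)
  show "finite {G \<in> nonempty_faces P. F \<subset> G}" using finite_nonempty_faces[OF P] by simp
  fix G assume "G \<in> {G \<in> nonempty_faces P. F \<subset> G}"
  then have G: "G \<in> nonempty_faces P" "F \<subset> G" by auto
  have "degree (gtilde P G * [:-1, 1:] ^ (codim_in G F - 1)) \<le> codim_in P G + (codim_in G F - 1)"
    using degree_mult_le[of "gtilde P G" "[:-1, 1:] ^ (codim_in G F - 1)"]
      degree_power_le[of "[:-1, 1::complex:]" "codim_in G F - 1"] degree_gtilde[OF P G(1)] by simp
  also have "\<dots> = codim_in P F - 1"
    using codim_in_add[OF P F G(1)] codim_in_pos[OF P F G] G(2) by auto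
  finally show "degree (gtilde P G * [:-1, 1:] ^ (codim_in G F - 1)) \<le> codim_in P F - 1" .
qed

text \<open>Stanley's duality for the g-polynomials of an Eulerian poset. The Eulerian condition says
  that (x-1)^rank and (1-x)^rank are inverse to each other in the incidence algebra.\<close>

lemma gtilde_duality:
  fixes P :: "(real^'n) set"
  assumes P: "polytope P"
    and euler: "\<And>F H. F \<in> nonempty_faces P \<Longrightarrow> H \<in> nonempty_faces P \<Longrightarrow> F \<subset> H \<Longrightarrow>
       (\<Sum>G\<in>{G \<in> nonempty_faces P. F \<subseteq> G \<and> G \<subseteq> H}. (-1) ^ codim_in G F :: complex) = 0"
  shows "F \<in> nonempty_faces P \<Longrightarrow> x \<noteq> 0 \<Longrightarrow>
    (\<Sum>G\<in>{G \<in> nonempty_faces P. F \<subseteq> G}. x ^ codim_in P G * poly (gtilde P G) (1 / x) * (1 - x) ^ codim_in G F)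
      = poly (gtilde P F) x"
proof (induction "codim_in P F" arbitrary: F x rule: less_induct)
  case less
  note F = less.prems(1)
  define N where "N = nonempty_faces P"
  have finN: "finite N" unfolding N_def by (rule finite_nonempty_faces[OF P])
  define g where "g = gtilde P"
  have PF: "F \<subseteq> P" by (rule nonempty_faces_D(4)[OF P F])
  show ?case
  proof (cases "F = P")
    case True
    have "{G \<in> nonempty_faces P. F \<subseteq> G} = {P}"
      using F True nonempty_faces_D(4)[OF P] by auto
    then show ?thesis using gtilde_rec[OF P F] True by (simp add: codim_in_def)
  next
    case False
    have PN: "P \<in> N"
      using P F PF by (auto simp: N_def nonempty_faces_def face_of_refl polytope_imp_convex)
    have cF: "0 < codim_in P F"
      using codim_in_pos[OF P F] PN False PF by (auto simp: N_def)
    define k where "k = codim_in P F - 1"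
    have k: "Suc k = codim_in P F" using cF by (simp add: k_def)
    define A where "A = [:1, -1:] * fdual P F"
    \<comment> \<open>The factor 1 - z raises the exponent \<open>codim_in G F - 1\<close> by one,
      at the cost of a sign.\<close>
    have A: "poly A z = - (\<Sum>G\<in>{G \<in> N. F \<subset> G}. poly (g G) z * (z - 1) ^ codim_in G F)" for z
    proof -
      have "poly A z = (\<Sum>G\<in>{G \<in> N. F \<subset> G}. (1 - z) * (poly (g G) z * (z - 1) ^ (codim_in G F - 1)))"
        unfolding A_def fdual_def N_def g_def poly_mult poly_sum sum_distrib_left by simp
      also have "\<dots> = (\<Sum>G\<in>{G \<in> N. F \<subset> G}. - (poly (g G) z * (z - 1) ^ codim_in G F))"
      proof (rule sum.cong[OF refl])
        fix G assume "G \<in> {G \<in> N. F \<subset> G}"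
        then have "0 < codim_in G F" using codim_in_pos[OF P F] by (auto simp: N_def)
        then show "(1 - z) * (poly (g G) z * (z - 1) ^ (codim_in G F - 1)) = - (poly (g G) z * (z - 1) ^ codim_in G F)"
          by (cases "codim_in G F") (auto simp: algebra_simps)
      qed
      finally show ?thesis by (simp add: sum_negf)
    qed
    \<comment> \<open>The induction hypothesis at 1/z, multiplied by z to the codimension of
      \<open>G\<close>. The argument must therefore vary in the induction.\<close>
    have hat: "(\<Sum>H\<in>{H \<in> N. G \<subseteq> H}. poly (g H) z * (z - 1) ^ codim_in H G) = z ^ codim_in P G * poly (g G) (1 / z)"
      if G: "G \<in> N" "F \<subset> G" and z: "z \<noteq> 0" for G z
    proof -
      have GP: "G \<in> nonempty_faces P" using G(1) by (simp add: N_def)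
      have lt: "codim_in P G < codim_in P F"
        using codim_in_add[OF P F GP] codim_in_pos[OF P F GP] G(2) by auto
      have "z ^ codim_in P G * poly (g G) (1 / z) = z ^ codim_in P G * (\<Sum>H\<in>{H \<in> N. G \<subseteq> H}.
          (1 / z) ^ codim_in P H * poly (g H) z * (1 - 1 / z) ^ codim_in H G)"
        using less.hyps[OF lt GP, of "1 / z"] z by (simp add: g_def N_def)
      also have "\<dots> = (\<Sum>H\<in>{H \<in> N. G \<subseteq> H}. poly (g H) z * (z - 1) ^ codim_in H G)"
        unfolding sum_distrib_left
      proof (rule sum.cong[OF refl])
        fix H assume "H \<in> {H \<in> N. G \<subseteq> H}"
        then have c: "codim_in P G = codim_in P H + codim_in H G"
          using codim_in_add[OF P GP] by (auto simp: N_def)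
        have "z ^ codim_in P G * ((1 / z) ^ codim_in P H * poly (g H) z * (1 - 1 / z) ^ codim_in H G)
           = (z * (1 / z)) ^ codim_in P H * poly (g H) z * (z * (1 - 1 / z)) ^ codim_in H G"
          unfolding c power_add power_mult_distrib by (simp only: mult_ac)
        moreover have "z * (1 / z) = 1" "z * (1 - 1 / z) = z - 1" using z by (auto simp: field_simps)
        ultimately show "z ^ codim_in P G * ((1 / z) ^ codim_in P H * poly (g H) z * (1 - 1 / z) ^ codim_in H G)
           = poly (g H) z * (z - 1) ^ codim_in H G" by (simp only: power_one mult_1)
      qed
      finally show ?thesis ..
    qed
    \<comment> \<open>The Euler relation with its bottom term, equal to 1, removed.\<close>
    have inner: "(\<Sum>G\<in>{G \<in> N. F \<subset> G \<and> G \<subseteq> H}. (-1) ^ codim_in G F :: complex) = -1" if H: "H \<in> N" "F \<subset> H" for H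
    proof -
      have "{G \<in> N. F \<subseteq> G \<and> G \<subseteq> H} = insert F {G \<in> N. F \<subset> G \<and> G \<subseteq> H}"
        using F H by (auto simp: N_def)
      then have "(\<Sum>G\<in>{G \<in> N. F \<subseteq> G \<and> G \<subseteq> H}. (-1) ^ codim_in G F :: complex)
          = 1 + (\<Sum>G\<in>{G \<in> N. F \<subset> G \<and> G \<subseteq> H}. (-1) ^ codim_in G F)"
        using finN by (simp add: codim_in_def)
      with euler[OF F, of H] H show ?thesis by (simp add: N_def add_eq_0_iff)
    qed
    \<comment> \<open>After expanding each reflected g-polynomial by \<open>hat\<close>, the powers
      of z - 1 combine to an exponent depending only on \<open>H\<close> and \<open>F\<close>.
      Swapping the sums leaves a pure sign sum over \<open>G\<close>, which \<open>inner\<close>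
      evaluates to -1.\<close>
    have refl_sum: "(\<Sum>G\<in>{G \<in> N. F \<subset> G}. z ^ codim_in P G * poly (g G) (1 / z) * (1 - z) ^ codim_in G F) = poly A z"
      if z: "z \<noteq> 0" for z
    proof -
      have "(\<Sum>G\<in>{G \<in> N. F \<subset> G}. z ^ codim_in P G * poly (g G) (1 / z) * (1 - z) ^ codim_in G F)
         = (\<Sum>G\<in>{G \<in> N. F \<subset> G}. \<Sum>H\<in>{H \<in> N. G \<subseteq> H}. poly (g H) z * (z - 1) ^ codim_in H F * (-1) ^ codim_in G F)"
      proof (rule sum.cong[OF refl])
        fix G assume "G \<in> {G \<in> N. F \<subset> G}"
        then have G: "G \<in> N" "F \<subset> G" by auto
        have "z ^ codim_in P G * poly (g G) (1 / z) * (1 - z) ^ codim_in G F =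
          (\<Sum>H\<in>{H \<in> N. G \<subseteq> H}. poly (g H) z * (z - 1) ^ codim_in H G * (1 - z) ^ codim_in G F)"
          unfolding hat[OF G z, symmetric] sum_distrib_right ..
        also have "\<dots> = (\<Sum>H\<in>{H \<in> N. G \<subseteq> H}. poly (g H) z * (z - 1) ^ codim_in H F * (-1) ^ codim_in G F)"
        proof (rule sum.cong[OF refl])
          fix H assume "H \<in> {H \<in> N. G \<subseteq> H}"
          then have "codim_in H F = codim_in H G + codim_in G F"
            using aff_dim_subset[of F G] aff_dim_subset[of G H] G by (auto simp: codim_in_def)
          moreover have "(1 - z) ^ codim_in G F = (z - 1) ^ codim_in G F * (-1) ^ codim_in G F"
            by (simp flip: power_mult_distrib)
          ultimately show "poly (g H) z * (z - 1) ^ codim_in H G * (1 - z) ^ codim_in G F =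
              poly (g H) z * (z - 1) ^ codim_in H F * (-1) ^ codim_in G F"
            by (simp add: power_add mult_ac)
        qed
        finally show "z ^ codim_in P G * poly (g G) (1 / z) * (1 - z) ^ codim_in G F =
          (\<Sum>H\<in>{H \<in> N. G \<subseteq> H}. poly (g H) z * (z - 1) ^ codim_in H F * (-1) ^ codim_in G F)" .
      qed
      also have "\<dots> = (\<Sum>G\<in>{G \<in> N. F \<subset> G}. \<Sum>H\<in>{H \<in> {H \<in> N. F \<subset> H}. G \<subseteq> H}. poly (g H) z * (z - 1) ^ codim_in H F * (-1) ^ codim_in G F)"
        by (intro sum.cong) auto
      also have "\<dots> = (\<Sum>H\<in>{H \<in> N. F \<subset> H}. \<Sum>G\<in>{G \<in> {G \<in> N. F \<subset> G}. G \<subseteq> H}. poly (g H) z * (z - 1) ^ codim_in H F * (-1) ^ codim_in G F)"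
        using finN by (intro sum.swap_restrict) auto
      also have "\<dots> = (\<Sum>H\<in>{H \<in> N. F \<subset> H}. - (poly (g H) z * (z - 1) ^ codim_in H F))"
      proof (rule sum.cong[OF refl])
        fix H assume "H \<in> {H \<in> N. F \<subset> H}"
        then have "(\<Sum>G\<in>{G \<in> {G \<in> N. F \<subset> G}. G \<subseteq> H}. (-1) ^ codim_in G F :: complex) = -1"
          using inner[of H] by (simp add: conj_ac)
        then show "(\<Sum>G\<in>{G \<in> {G \<in> N. F \<subset> G}. G \<subseteq> H}. poly (g H) z * (z - 1) ^ codim_in H F * (-1) ^ codim_in G F)
           = - (poly (g H) z * (z - 1) ^ codim_in H F)"
          by (simp only: sum_distrib_left[symmetric] mult_minus1_right)
      qed
      finally show ?thesis unfolding A by (simp add: sum_negf)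
    qed
    \<comment> \<open>Clearing denominators in A(1/z) reproduces minus the sum just evaluated; this
      antisymmetry is the hypothesis of \<open>g_trunc_reflection\<close>.\<close>
    have anti: "z ^ Suc k * poly A (1 / z) = - poly A z" if z: "z \<noteq> 0" for z
    proof -
      have "z ^ Suc k * poly A (1 / z) = - (\<Sum>G\<in>{G \<in> N. F \<subset> G}. z ^ codim_in P F * (poly (g G) (1 / z) * (1 / z - 1) ^ codim_in G F))"
        unfolding A k by (simp add: sum_distrib_left)
      also have "(\<Sum>G\<in>{G \<in> N. F \<subset> G}. z ^ codim_in P F * (poly (g G) (1 / z) * (1 / z - 1) ^ codim_in G F))
         = (\<Sum>G\<in>{G \<in> N. F \<subset> G}. z ^ codim_in P G * poly (g G) (1 / z) * (1 - z) ^ codim_in G F)"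
      proof (rule sum.cong[OF refl])
        fix G assume "G \<in> {G \<in> N. F \<subset> G}"
        then have c: "codim_in P F = codim_in P G + codim_in G F"
          using codim_in_add[OF P F, of G] by (auto simp: N_def)
        have "z ^ codim_in P F * (poly (g G) (1 / z) * (1 / z - 1) ^ codim_in G F)
          = z ^ codim_in P G * poly (g G) (1 / z) * (z * (1 / z - 1)) ^ codim_in G F"
          unfolding c power_add power_mult_distrib by (simp only: mult_ac)
        also have "z * (1 / z - 1) = 1 - z" using z by (simp add: field_simps)
        finally show "z ^ codim_in P F * (poly (g G) (1 / z) * (1 / z - 1) ^ codim_in G F)
          = z ^ codim_in P G * poly (g G) (1 / z) * (1 - z) ^ codim_in G F" .
      qed
      finally show ?thesis unfolding refl_sum[OF z] .
    qed
    have gF: "g F = g_trunc k (fdual P F)"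
      using gtilde_rec[OF P F] False by (simp add: g_def k_def)
    \<comment> \<open>In the claimed sum the term for \<open>F\<close> itself is the reflected
      g-polynomial and all others add up to \<open>A\<close>. The claim is thus the reflection
      identity for \<open>g F\<close>.\<close>
    have "poly (g F) x - x ^ Suc k * poly (g F) (1 / x) = poly A x"
      unfolding gF A_def
      by (rule g_trunc_reflection) (use degree_fdual[OF P F] anti less.prems(2) in \<open>simp_all add: k_def A_def\<close>)
    moreover have "{G \<in> N. F \<subseteq> G} = insert F {G \<in> N. F \<subset> G}" using F by (auto simp: N_def)
    then have "(\<Sum>G\<in>{G \<in> N. F \<subseteq> G}. x ^ codim_in P G * poly (g G) (1 / x) * (1 - x) ^ codim_in G F)
      = x ^ codim_in P F * poly (g F) (1 / x) + poly A x"
      using finN refl_sum[OF less.prems(2)] by (simp add: codim_in_def)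
    ultimately show ?thesis unfolding k by (simp add: N_def g_def diff_eq_eq add.commute)
  qed
qed

section \<open>The functional equation\<close>

text \<open>Local finiteness: the inverse matrix sends a bounded set to a bounded set, which
  contains only finitely many integer vectors.\<close>

lemma is_lattice_discrete_subgroup:
  fixes M :: "(real^'n) set"
  assumes "is_lattice M"
  shows "discrete_subgroup M"
proof -
  obtain A :: "real^'n^'n" where A: "invertible A" and M: "M = (\<lambda>z. A *v z) ` {z. \<forall>i. z $ i \<in> \<int>}"
    using assms by (auto simp: is_lattice_def lattice_of_def)
  let ?Z = "{z :: real^'n. \<forall>i. z $ i \<in> \<int>}"
  have "finite (M \<inter> S)" if S: "bounded S" for S
  proof -
    obtain A' where A': "A' ** A = mat 1" using A by (auto simp: invertible_def)
    have "bounded ((\<lambda>x. A' *v x) ` S)"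
      using S by (intro bounded_linear_image) (auto intro: matrix_vector_mul_bounded_linear)
    then obtain R where R: "\<And>x. x \<in> S \<Longrightarrow> norm (A' *v x) \<le> R"
      unfolding bounded_iff by auto
    let ?K = "{z :: real^'n. \<forall>i. z $ i \<in> of_int ` {-\<lceil>R\<rceil>..\<lceil>R\<rceil>}}"
    have "?K \<subseteq> vec_lambda ` {f. \<forall>i. f i \<in> of_int ` {-\<lceil>R\<rceil>..\<lceil>R\<rceil>}}"
    proof
      fix z assume "z \<in> ?K"
      then show "z \<in> vec_lambda ` {f. \<forall>i. f i \<in> of_int ` {-\<lceil>R\<rceil>..\<lceil>R\<rceil>}}"
        by (intro image_eqI[where x = "vec_nth z"]) auto
    qed
    moreover have "finite {f :: 'n \<Rightarrow> real. \<forall>i. f i \<in> of_int ` {-\<lceil>R\<rceil>..\<lceil>R\<rceil>}}"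
      using finite_set_of_finite_funs[of "UNIV :: 'n set" "of_int ` {-\<lceil>R\<rceil>..\<lceil>R\<rceil>} :: real set" 0] by simp
    ultimately have finK: "finite ?K" by (meson finite_imageI finite_subset)
    have "M \<inter> S \<subseteq> (\<lambda>z. A *v z) ` ?K"
    proof
      fix x assume x: "x \<in> M \<inter> S"
      then obtain z where z: "x = A *v z" "\<forall>i. z $ i \<in> \<int>" using M by auto
      have "A' *v x = z" unfolding z(1) matrix_vector_mul_assoc A' by simp
      then have nz: "norm z \<le> R" using R x by auto
      have "z $ i \<in> of_int ` {-\<lceil>R\<rceil>..\<lceil>R\<rceil>}" for i
      proof -
        obtain k where k: "z $ i = of_int k" using z(2) by (metis Ints_cases)
        have "\<bar>of_int k\<bar> \<le> R" using component_le_norm_cart[of z i] nz k by simp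
        then have "k \<in> {-\<lceil>R\<rceil>..\<lceil>R\<rceil>}" by (simp; linarith)
        then show ?thesis using k by blast
      qed
      then show "x \<in> (\<lambda>z. A *v z) ` ?K" using z(1) by blast
    qed
    then show ?thesis using finK by (meson finite_imageI finite_subset)
  qed
  moreover have "0 \<in> M" unfolding M by (intro image_eqI[of _ _ 0]) auto
  moreover have "x + y \<in> M" if xy: "x \<in> M" "y \<in> M" for x y
  proof -
    obtain u v where "x = A *v u" "y = A *v v" "u \<in> ?Z" "v \<in> ?Z" using xy M by auto
    then show ?thesis
      unfolding M by (intro image_eqI[of _ _ "u + v"]) (auto simp: matrix_vector_right_distrib)
  qed
  moreover have "- x \<in> M" if x: "x \<in> M" for x
  proof -
    obtain u where "x = A *v u" "u \<in> ?Z" using x M by auto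
    then show ?thesis
      unfolding M by (intro image_eqI[of _ _ "- u"]) (auto simp: linear_neg[OF matrix_vector_mul_linear])
  qed
  ultimately show ?thesis by (simp add: discrete_subgroup_def)
qed

lemma homog_poly_fun_polyfun:
  assumes "homog_poly_fun d \<phi>"
  shows "polyfun \<phi>"
proof -
  obtain c where c: "\<And>x. \<phi> x = (\<Sum>\<alpha>\<in>{\<alpha>. sum \<alpha> UNIV = d}. c \<alpha> * (\<Prod>i\<in>UNIV. complex_of_real (x $ i) ^ \<alpha> i))"
    using assms by (auto simp: homog_poly_fun_def)
  have "{\<alpha> :: 'a \<Rightarrow> nat. sum \<alpha> UNIV = d} \<subseteq> {\<alpha>. \<forall>i. (i \<in> UNIV \<longrightarrow> \<alpha> i \<in> {..d}) \<and> (i \<notin> UNIV \<longrightarrow> \<alpha> i = 0)}"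
    using member_le_sum[of _ "UNIV :: 'a set"] by fastforce
  moreover have "finite {\<alpha> :: 'a \<Rightarrow> nat. \<forall>i. (i \<in> UNIV \<longrightarrow> \<alpha> i \<in> {..d}) \<and> (i \<notin> UNIV \<longrightarrow> \<alpha> i = 0)}"
    by (rule finite_set_of_finite_funs) auto
  ultimately have fin: "finite {\<alpha> :: 'a \<Rightarrow> nat. sum \<alpha> UNIV = d}" by (rule finite_subset)
  have "linear (\<lambda>x :: real^'a. x $ i)" for i by (simp add: linear_iff)
  then show ?thesis
    unfolding c[abs_def] using fin
    by (intro polyfun_sum polyfun.mult polyfun.const polyfun_prod polyfun_power polyfun.linear) auto
qed

lemma homog_poly_fun_uminus:
  assumes "homog_poly_fun d \<phi>"
  shows "\<phi> (- x) = (-1) ^ d * \<phi> x"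
proof -
  obtain c where c: "\<And>x. \<phi> x = (\<Sum>\<alpha>\<in>{\<alpha>. sum \<alpha> UNIV = d}. c \<alpha> * (\<Prod>i\<in>UNIV. complex_of_real (x $ i) ^ \<alpha> i))"
    using assms by (auto simp: homog_poly_fun_def)
  show ?thesis
    unfolding c sum_distrib_left
  proof (rule sum.cong[OF refl])
    fix \<alpha> :: "'a \<Rightarrow> nat" assume \<alpha>: "\<alpha> \<in> {\<alpha>. sum \<alpha> UNIV = d}"
    have "(\<Prod>i\<in>UNIV. complex_of_real ((- x) $ i) ^ \<alpha> i) = (\<Prod>i\<in>UNIV. (-1) ^ \<alpha> i * complex_of_real (x $ i) ^ \<alpha> i)"
      by (intro prod.cong) (auto simp flip: power_mult_distrib)
    also have "\<dots> = (-1) ^ d * (\<Prod>i\<in>UNIV. complex_of_real (x $ i) ^ \<alpha> i)"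
      using \<alpha> by (simp add: prod.distrib flip: power_sum)
    finally show "c \<alpha> * (\<Prod>i\<in>UNIV. complex_of_real ((- x) $ i) ^ \<alpha> i) = (-1) ^ d * (c \<alpha> * (\<Prod>i\<in>UNIV. complex_of_real (x $ i) ^ \<alpha> i))"
      by simp
  qed
qed

text \<open>A polynomial is determined by its values at positive integers, so the definite
  description denotes the polynomial supplied by reciprocity.\<close>

lemma weighted_ehrhart_reciprocity:
  assumes M: "discrete_subgroup M" and P: "polytope P" "P \<noteq> {}" "{x. x extreme_point_of P} \<subseteq> M"
    and \<phi>: "polyfun \<phi>" and q: "q > (0::nat)"
  shows "poly (weighted_ehrhart \<phi> M P) (of_nat q) = (\<Sum>m\<in>M \<inter> (\<lambda>x. real q *\<^sub>R x) ` P. \<phi> m)"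
    and "poly (weighted_ehrhart \<phi> M P) (- of_nat q) =
      (-1) ^ nat (aff_dim P) * (\<Sum>m\<in>M \<inter> (\<lambda>x. real q *\<^sub>R x) ` rel_interior P. \<phi> (- m))"
proof -
  obtain S where S: "\<And>q::nat. q > 0 \<Longrightarrow>
    poly S (of_nat q) = (\<Sum>m\<in>M \<inter> (\<lambda>x. real q *\<^sub>R x) ` P. \<phi> m) \<and>
    poly S (- of_nat q) = (-1) ^ nat (aff_dim P) *
       (\<Sum>m\<in>M \<inter> (\<lambda>x. real q *\<^sub>R x) ` rel_interior P. \<phi> (- m))"
    using weighted_reciprocity[OF M P \<phi>] by auto
  have "weighted_ehrhart \<phi> M P = S"
    unfolding weighted_ehrhart_def
  proof (rule the_equality)
    fix p assume "\<forall>q>0. poly p (of_nat q) = (\<Sum>m\<in>M \<inter> (\<lambda>x. real q *\<^sub>R x) ` P. \<phi> m)"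
    then show "p = S" using S by (intro poly_eq_if_agree_on_pos_nat) simp
  qed (use S in simp)
  then show "poly (weighted_ehrhart \<phi> M P) (of_nat q) = (\<Sum>m\<in>M \<inter> (\<lambda>x. real q *\<^sub>R x) ` P. \<phi> m)"
    "poly (weighted_ehrhart \<phi> M P) (- of_nat q) =
      (-1) ^ nat (aff_dim P) * (\<Sum>m\<in>M \<inter> (\<lambda>x. real q *\<^sub>R x) ` rel_interior P. \<phi> (- m))"
    using S[OF q] by simp_all
qed

text \<open>The faces of \<open>H\<close> are the faces of \<open>P\<close> inside \<open>H\<close>,
  so the relation for faces above \<open>F\<close> in the polytope \<open>H\<close> is the one for
  this interval, up to the global sign (-1)^dim F.\<close>

lemma euler_relation_faces:
  fixes P :: "(real^'n) set"
  assumes M: "discrete_subgroup M" and P: "polytope P" "{x. x extreme_point_of P} \<subseteq> M"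
    and F: "F \<in> nonempty_faces P" and H: "H \<in> nonempty_faces P" and FH: "F \<subset> H"
  shows "(\<Sum>G\<in>{G \<in> nonempty_faces P. F \<subseteq> G \<and> G \<subseteq> H}. (-1) ^ codim_in G F :: complex) = 0"
proof -
  note H' = nonempty_faces_D[OF P(1) H]
  note F' = nonempty_faces_D[OF P(1) F]
  have face: "G face_of H \<longleftrightarrow> G face_of P \<and> G \<subseteq> H" for G by (rule face_of_face[OF H'(1)])
  have FinH: "F \<in> nonempty_faces H" using F' FH by (simp add: nonempty_faces_def face)
  have "{G \<in> nonempty_faces P. F \<subseteq> G \<and> G \<subseteq> H} = {G. G face_of H \<and> F \<subseteq> G}"
    using F'(2) by (auto simp: nonempty_faces_def face)
  moreover have "(-1) ^ codim_in G F = (-1) ^ nat (aff_dim F) * (-1) ^ nat (aff_dim G :: int) * (1 :: complex)"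
    if "G \<in> {G. G face_of H \<and> F \<subseteq> G}" for G
  proof -
    have "nat (aff_dim G) = nat (aff_dim F) + codim_in G F"
      using aff_dim_subset[of F G] that F'(5) by (simp add: codim_in_def)
    then show ?thesis by (simp add: power_add mult.assoc[symmetric] flip: power_mult_distrib)
  qed
  ultimately have "(\<Sum>G\<in>{G \<in> nonempty_faces P. F \<subseteq> G \<and> G \<subseteq> H}. (-1) ^ codim_in G F :: complex)
      = (-1) ^ nat (aff_dim F) * (\<Sum>G\<in>{G. G face_of H \<and> F \<subseteq> G}. (-1) ^ nat (aff_dim G))"
    by (simp add: sum_distrib_left)
  also have "(\<Sum>G\<in>{G. G face_of H \<and> F \<subseteq> G}. (-1) ^ nat (aff_dim G) :: complex) = 0"
    using euler_relation_interval[OF M H'(3) face_extreme_points_subset[OF P(2) H'(1)] FinH] FH by auto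
  finally show ?thesis by simp
qed

theorem theorem2p3:
  fixes M P :: "(real^'n) set" and \<phi> :: "real^'n \<Rightarrow> complex" and d :: nat
  assumes "is_lattice M"
    and "lattice_polytope M P"
    and "aff_dim P = int CARD('n)"
    and "homog_poly_fun d \<phi>"
    and "\<phi> \<noteq> (\<lambda>_. 0)"
  shows "\<forall>q y :: complex. y \<noteq> 0 \<longrightarrow>
           Gphi d \<phi> M P q y = (- y) ^ (CARD('n) + d) * Gphi d \<phi> M P (- q) (1 / y)"
proof (intro allI impI)
  fix q y :: complex assume y: "y \<noteq> 0"
  \<comment> \<open>With x = -y the prefactor y + 1 becomes 1 - x and the argument -1/y becomes 1/x,
    the shape in which the duality is stated.\<close>
  define x where "x = - y"
  have x: "x \<noteq> 0" "y = - x" using y by (simp_all add: x_def)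
  have M: "discrete_subgroup M" using assms(1) by (rule is_lattice_discrete_subgroup)
  obtain S where S: "finite S" "S \<subseteq> M" "P = convex hull S"
    using assms(2) by (auto simp: lattice_polytope_def)
  have P: "polytope P" using S by (auto simp: polytope_def)
  have ext: "{x. x extreme_point_of P} \<subseteq> M"
    using S extreme_points_of_convex_hull[of S] by simp
  have pf: "polyfun \<phi>" using assms(4) by (rule homog_poly_fun_polyfun)
  define N where "N = nonempty_faces P"
  have finN: "finite N" unfolding N_def by (rule finite_nonempty_faces[OF P])
  define W where "W F = weighted_ehrhart \<phi> M F" for F
  define g where "g = gtilde P"
  define r where "r F = nat (aff_dim F)" for F :: "(real^'n) set"
  have codim: "CARD('n) - r F = codim_in P F" "CARD('n) = r F + codim_in P F" if "F \<in> N" for F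
    using nonempty_faces_D(5,6)[OF P, of F] that assms(3) by (simp_all add: N_def codim_in_def r_def)
  have Gphi: "Gphi d \<phi> M P q y = (y + 1) ^ d * (\<Sum>F\<in>N. (y + 1) ^ r F * (- y) ^ codim_in P F * poly (W F) q * poly (g F) (- 1 / y))" for q y
    unfolding Gphi_def N_def[unfolded nonempty_faces_def, symmetric] W_def g_def
    by (simp add: codim r_def[symmetric])
  define I where "I F q = (\<Sum>m\<in>M \<inter> (\<lambda>x. real q *\<^sub>R x) ` rel_interior F. \<phi> m)" for F and q :: nat
  have W: "poly (W F) (of_nat q) = (\<Sum>m\<in>M \<inter> (\<lambda>x. real q *\<^sub>R x) ` F. \<phi> m)"
    \<comment> \<open>Homogeneity moves the minus sign out of \<phi>(-m); this is where (-1)^d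
      arises.\<close>
    "poly (W F) (- of_nat q) = (-1) ^ (r F + d) * I F q"
    if F: "F \<in> N" and q: "q > 0" for F and q :: nat
  proof -
    note F' = nonempty_faces_D[OF P F[unfolded N_def]]
    note R = weighted_ehrhart_reciprocity[OF M F'(3,2) face_extreme_points_subset[OF ext F'(1)] pf q]
    show "poly (W F) (of_nat q) = (\<Sum>m\<in>M \<inter> (\<lambda>x. real q *\<^sub>R x) ` F. \<phi> m)"
      unfolding W_def by (rule R(1))
    show "poly (W F) (- of_nat q) = (-1) ^ (r F + d) * I F q"
      unfolding W_def R(2) I_def homog_poly_fun_uminus[OF assms(4)]
      by (simp add: r_def power_add sum_distrib_left mult_ac)
  qed
  have W_int: "poly (W F) (of_nat q) = (\<Sum>G\<in>{G \<in> N. G \<subseteq> F}. I G q)" if F: "F \<in> N" and q: "q > 0" for F and q :: nat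
  proof -
    note F' = nonempty_faces_D[OF P F[unfolded N_def]]
    have "nonempty_faces F = {G \<in> N. G \<subseteq> F}"
      using face_of_face[OF F'(1)] by (auto simp: N_def nonempty_faces_def)
    then show ?thesis
      unfolding W(1)[OF F q] I_def using sum_over_face_interiors[OF M F'(3) q, of \<phi>] by simp
  qed
  define c where "c = (- y) ^ (CARD('n) + d) * (1 / y + 1) ^ d"
  \<comment> \<open>For fixed y both sides are polynomials in q. Comparing them at positive integers
    settles all complex q.\<close>
  define L where "L = smult ((y + 1) ^ d)
     (\<Sum>F\<in>N. smult ((y + 1) ^ r F * (- y) ^ codim_in P F * poly (g F) (- 1 / y)) (W F))"
  define R where "R = smult c
     (\<Sum>F\<in>N. smult ((1 / y + 1) ^ r F * (- (1 / y)) ^ codim_in P F * poly (g F) (- y)) (pcompose (W F) [:0, -1:]))"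
  have "L = R"
  proof (rule poly_eq_if_agree_on_pos_nat)
    fix q :: nat assume q: "q > 0"
    have dual: "(\<Sum>F\<in>{F \<in> N. G \<subseteq> F}. x ^ codim_in P F * poly (g F) (1 / x) * (1 - x) ^ codim_in F G) = poly (g G) x"
      if "G \<in> N" for G
      unfolding N_def g_def
      by (rule gtilde_duality[OF P euler_relation_faces[OF M P ext]]) (use that x in \<open>auto simp: N_def\<close>)
    \<comment> \<open>Collecting the terms by the face \<open>G\<close> whose interior is counted
      leaves, for each \<open>G\<close>, the duality sum over the faces containing it.\<close>
    have "poly L (of_nat q) = (1 - x) ^ d * (\<Sum>F\<in>N. \<Sum>G\<in>{G \<in> N. G \<subseteq> F}.
        (1 - x) ^ r F * x ^ codim_in P F * poly (g F) (1 / x) * I G q)"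
      unfolding L_def x(2) by (simp add: poly_sum W_int q sum_distrib_left)
    also have "(\<Sum>F\<in>N. \<Sum>G\<in>{G \<in> N. G \<subseteq> F}. (1 - x) ^ r F * x ^ codim_in P F * poly (g F) (1 / x) * I G q)
        = (\<Sum>G\<in>N. \<Sum>F\<in>{F \<in> N. G \<subseteq> F}. (1 - x) ^ r F * x ^ codim_in P F * poly (g F) (1 / x) * I G q)"
      using finN by (rule sum.swap_restrict[OF _ finN])
    also have "\<dots> = (\<Sum>G\<in>N. (1 - x) ^ r G * I G q * poly (g G) x)"
    proof (rule sum.cong[OF refl])
      fix G assume G: "G \<in> N"
      have "(\<Sum>F\<in>{F \<in> N. G \<subseteq> F}. (1 - x) ^ r F * x ^ codim_in P F * poly (g F) (1 / x) * I G q)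
        = (\<Sum>F\<in>{F \<in> N. G \<subseteq> F}. (1 - x) ^ r G * I G q * (x ^ codim_in P F * poly (g F) (1 / x) * (1 - x) ^ codim_in F G))"
      proof (rule sum.cong[OF refl])
        fix F assume "F \<in> {F \<in> N. G \<subseteq> F}"
        then have "r F = r G + codim_in F G"
          using aff_dim_subset[of G F] nonempty_faces_D(5)[OF P, of G] G by (simp add: r_def codim_in_def N_def)
        then show "(1 - x) ^ r F * x ^ codim_in P F * poly (g F) (1 / x) * I G q =
          (1 - x) ^ r G * I G q * (x ^ codim_in P F * poly (g F) (1 / x) * (1 - x) ^ codim_in F G)"
          by (simp add: power_add mult_ac)
      qed
      then show "(\<Sum>F\<in>{F \<in> N. G \<subseteq> F}. (1 - x) ^ r F * x ^ codim_in P F * poly (g F) (1 / x) * I G q)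
        = (1 - x) ^ r G * I G q * poly (g G) x"
        unfolding sum_distrib_left[symmetric] dual[OF G] .
    qed
    finally have Lq: "poly L (of_nat q) = (1 - x) ^ d * (\<Sum>G\<in>N. (1 - x) ^ r G * I G q * poly (g G) x)" .
    have yx: "1 / y + 1 = - (1 - x) / x" "- (1 / y) = 1 / x" "- y = x"
      using x by (auto simp: field_simps)
    have "poly R (of_nat q) = (\<Sum>F\<in>N. c * ((1 / y + 1) ^ r F * (- (1 / y)) ^ codim_in P F * poly (g F) (- y) * poly (W F) (- of_nat q)))"
      unfolding R_def by (simp add: poly_sum poly_pcompose sum_distrib_left)
    also have "\<dots> = (\<Sum>G\<in>N. (1 - x) ^ d * ((1 - x) ^ r G * I G q * poly (g G) x))"
    proof (rule sum.cong[OF refl])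
      fix F assume F: "F \<in> N"
      \<comment> \<open>The exponent n + d splits as (r F + d) + codimension. The codimension part
        cancels the powers of 1/x. The other part meets equally many factors -(1 - x)/x and equally
        many signs from reciprocity, and the three together give 1 - x.\<close>
      have "c * ((1 / y + 1) ^ r F * (- (1 / y)) ^ codim_in P F * poly (g F) (- y) * poly (W F) (- of_nat q))
        = (x * (- (1 - x) / x) * (-1)) ^ (r F + d) * (x * (1 / x)) ^ codim_in P F * I F q * poly (g F) x"
        unfolding c_def yx W(2)[OF F q] codim(2)[OF F] power_add power_mult_distrib by (simp only: mult_ac)
      moreover have "x * (- (1 - x) / x) * (-1) = 1 - x" "x * (1 / x) = 1" using x by simp_all
      ultimately show "c * ((1 / y + 1) ^ r F * (- (1 / y)) ^ codim_in P F * poly (g F) (- y) * poly (W F) (- of_nat q))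
        = (1 - x) ^ d * ((1 - x) ^ r F * I F q * poly (g F) x)"
        by (simp only: power_add power_one mult_1_left mult_1_right mult_ac)
    qed
    finally show "poly L (of_nat q) = poly R (of_nat q)" unfolding Lq by (simp add: sum_distrib_left)
  qed
  moreover have "Gphi d \<phi> M P q y = poly L q"
    unfolding Gphi L_def by (simp add: poly_sum mult_ac)
  moreover have "(- y) ^ (CARD('n) + d) * Gphi d \<phi> M P (- q) (1 / y) = poly R q"
    unfolding Gphi R_def c_def by (simp add: poly_sum poly_pcompose mult_ac add.commute)
  ultimately show "Gphi d \<phi> M P q y = (- y) ^ (CARD('n) + d) * Gphi d \<phi> M P (- q) (1 / y)" by simp
qed

end
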